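(* Let $(\Omega,\mathcal F)$ be a measurable space, $\mathfrak P$ a nonempty set of probability measures on it, and $\Phi=(\phi_{\mathbb P})_{\mathbb P\in\mathfrak P}$ a family of Orlicz functions. The following statements are equivalent: (1) $L^\infty(\mathfrak P)\subset L^\Phi(\mathfrak P)$. (2) $\phi_{\mathrm{Max}}$ is an Orlicz function, i.e., there exists some $x_0\in(0,\infty)$ with $\phi_{\mathrm{Max}}(x_0)\in[0,\infty)$. (3) There exist a nonempty set of probability measures $\mathfrak Q\subset \mathbf{ca}_+^1(L^\Phi(\mathfrak P))$ with $\mathfrak P\subset\mathfrak Q$ and a bounded weight function $\theta\colon\mathfrak Q\to(0,\infty)$ such that $\|X\|_{L^\Phi(\mathfrak P)}=\sup_{\mathbb Q\in\mathfrak Q}\theta(\mathbb Q)\|X\|_{L^1(\mathbb Q)}$ for all $X\in L^0(\mathfrak P)$ (both sides being elements of $[0,\infty]$). That is, $L^\Phi(\mathfrak P)$ is a weighted robust $L^1$-space. (4) There is a constant $\kappa>0$ such that $\|X\|_{L^\Phi(\mathfrak P)}\le\kappa\|X\|_{L^\infty(\mathfrak P)}$ for all $X\in L^\infty(\mathfrak P)$.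
   Context: $L^0(\mathfrak P)$ is the space of equivalence classes $[f]$ of measurable functions $f\colon\Omega\to\mathbb R$ under $f\sim g\iff \mathbb P(f=g)=1$ for all $\mathbb P\in\mathfrak P$ (equality $\mathfrak P$-quasi surely, $\mathfrak P$-q.s.), with the order $X\preceq Y$ iff $\mathbb P(f\le g)=1$ for all $\mathbb P\in\mathfrak P$, $f\in X$, $g\in Y$; it is a vector lattice. $L^\infty(\mathfrak P)\subset L^0(\mathfrak P)$ is the space of classes of bounded random variables, with norm $\|X\|_{L^\infty(\mathfrak P)}=\inf\{m>0: |X|\preceq m\mathbf 1_\Omega\}$. An Orlicz function is a lower semicontinuous, nondecreasing, convex function $\phi\colon[0,\infty)\to[0,\infty]$ with $\phi(0)=0$ such that there are $x_0,x_1>0$ with $\phi(x_0)<\infty$ and $\phi(x_1)>0$. Put $\phi_{\mathrm{Max}}(x)=\sup_{\mathbb P\in\mathfrak P}\phi_{\mathbb P}(x)$, $x\ge0$. For $X\in L^0(\mathfrak P)$, $$\|X\|_{L^\Phi(\mathfrak P)}=\inf\Big\{\lambda>0:\ \sup_{\mathbb P\in\mathfrak P}\mathbb E_{\mathbb P}[\phi_{\mathbb P}(\lambda^{-1}|X|)]\le1\Big\}\in[0,\infty],$$ and the robust Orlicz space is $L^\Phi(\mathfrak P)=\{X\in L^0(\mathfrak P): \|X\|_{L^\Phi(\mathfrak P)}<\infty\}$. $\mathbf{ca}$ is the space of signed measures on $(\Omega,\mathcal F)$ of finite total variation, $|\mu|$ the total variation measure, and $\mathbf{ca}(\mathfrak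 P)$ is the set of $\mu\in\mathbf{ca}$ with $\mu\ll\mathfrak P$, i.e. $|\mu|(N)=0$ for every $N\in\mathcal F$ with $\sup_{\mathbb P\in\mathfrak P}\mathbb P(N)=0$. $\mathbf{ca}(L^\Phi(\mathfrak P))$ is the set of $\mu\in\mathbf{ca}(\mathfrak P)$ such that every $X\in L^\Phi(\mathfrak P)$ is $|\mu|$-integrable and $X\mapsto\int X\,d|\mu|$ is norm continuous on $L^\Phi(\mathfrak P)$; $\mathbf{ca}_+^1(L^\Phi(\mathfrak P))$ is the set of probability measures in $\mathbf{ca}(L^\Phi(\mathfrak P))$. For such $\mathbb Q$, $\|X\|_{L^1(\mathbb Q)}=\mathbb E_{\mathbb Q}[|X|]\in[0,\infty]$. *)

theory Defs
  imports "HOL-Probability.Probability"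
begin

section \<open>Quasi-sure equivalence classes\<close>

text \<open>
  A set \<open>\<PP>\<close> of probability measures on a measurable space \<open>M\<close> is a subset of
  \<open>prob_measures M\<close>; only \<open>space M\<close> and \<open>sets M\<close> matter, never the measure carried by \<open>M\<close>.
  Values of functions outside \<open>space M\<close> do not affect almost-everywhere statements, so they
  play no role in the equivalence classes below.
\<close>

definition prob_measures :: "'a measure \<Rightarrow> 'a measure set" where
  "prob_measures M = {P. prob_space P \<and> sets P = sets M}"

definition qs_rel :: "'a measure \<Rightarrow> 'a measure set \<Rightarrow> (('a \<Rightarrow> real) \<times> ('a \<Rightarrow> real)) set" where
  "qs_rel M \<PP> = {(f, g). f \<in> borel_measurable M \<and> g \<in> borel_measurable M \<and>
                       (\<forall>P\<in>\<PP>. AE \<omega> in P. f \<omega> = g \<omega>)}"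

definition L0 :: "'a measure \<Rightarrow> 'a measure set \<Rightarrow> ('a \<Rightarrow> real) set set" where
  "L0 M \<PP> = borel_measurable M // qs_rel M \<PP>"

definition qs_class :: "'a measure \<Rightarrow> 'a measure set \<Rightarrow> ('a \<Rightarrow> real) \<Rightarrow> ('a \<Rightarrow> real) set" where
  "qs_class M \<PP> f = qs_rel M \<PP> `` {f}"

text \<open>
  Operations and functionals on classes are evaluated at a representative; they do not depend
  on its choice (see e.g. \<open>LPhi_norm_qs_class\<close> and \<open>L1_norm_qs_class\<close>).
\<close>

definition rep :: "('a \<Rightarrow> real) set \<Rightarrow> 'a \<Rightarrow> real" where
  "rep X = (SOME f. f \<in> X)"

definition qs_le :: "'a measure set \<Rightarrow> ('a \<Rightarrow> real) set \<Rightarrow> ('a \<Rightarrow> real) set \<Rightarrow> bool" where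
  "qs_le \<PP> X Y \<longleftrightarrow> (\<forall>f\<in>X. \<forall>g\<in>Y. \<forall>P\<in>\<PP>. AE \<omega> in P. f \<omega> \<le> g \<omega>)"

definition qs_abs :: "'a measure \<Rightarrow> 'a measure set \<Rightarrow> ('a \<Rightarrow> real) set \<Rightarrow> ('a \<Rightarrow> real) set" where
  "qs_abs M \<PP> X = qs_class M \<PP> (\<lambda>\<omega>. \<bar>rep X \<omega>\<bar>)"

definition qs_minus ::
  "'a measure \<Rightarrow> 'a measure set \<Rightarrow> ('a \<Rightarrow> real) set \<Rightarrow> ('a \<Rightarrow> real) set \<Rightarrow> ('a \<Rightarrow> real) set" where
  "qs_minus M \<PP> X Y = qs_class M \<PP> (\<lambda>\<omega>. rep X \<omega> - rep Y \<omega>)"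

definition Linf :: "'a measure \<Rightarrow> 'a measure set \<Rightarrow> ('a \<Rightarrow> real) set set" where
  "Linf M \<PP> = {X \<in> L0 M \<PP>. \<exists>f\<in>X. bounded (f ` space M)}"

definition Linf_norm :: "'a measure \<Rightarrow> 'a measure set \<Rightarrow> ('a \<Rightarrow> real) set \<Rightarrow> ennreal" where
  "Linf_norm M \<PP> X =
     Inf {ennreal m | m. m > 0 \<and> qs_le \<PP> (qs_abs M \<PP> X) (qs_class M \<PP> (\<lambda>_. m))}"


section \<open>Orlicz functions and robust Orlicz spaces\<close>

text \<open>
  Functions on \<open>[0,\<infinity>)\<close> are modelled as functions on \<open>real\<close> whose values at negative
  arguments are irrelevant. In \<open>ennreal\<close> one has \<open>0 * \<infinity> = 0\<close>, the usual convention for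
  extended-valued convexity.
\<close>

definition lsc_nonneg :: "(real \<Rightarrow> ennreal) \<Rightarrow> bool" where
  "lsc_nonneg \<phi> \<longleftrightarrow> (\<forall>x\<ge>0. \<phi> x \<le> Liminf (at x within {0..}) \<phi>)"

definition convex_nonneg :: "(real \<Rightarrow> ennreal) \<Rightarrow> bool" where
  "convex_nonneg \<phi> \<longleftrightarrow>
     (\<forall>x\<ge>0. \<forall>y\<ge>0. \<forall>t\<in>{0..1}.
        \<phi> ((1 - t) * x + t * y) \<le> ennreal (1 - t) * \<phi> x + ennreal t * \<phi> y)"

definition Orlicz_function :: "(real \<Rightarrow> ennreal) \<Rightarrow> bool" where
  "Orlicz_function \<phi> \<longleftrightarrow>
     lsc_nonneg \<phi> \<and> mono_on {0..} \<phi> \<and> convex_nonneg \<phi> \<and> \<phi> 0 = 0 \<and>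
     (\<exists>x0>0. \<phi> x0 < \<infinity>) \<and> (\<exists>x1>0. \<phi> x1 > 0)"

definition phi_Max :: "'a measure set \<Rightarrow> ('a measure \<Rightarrow> real \<Rightarrow> ennreal) \<Rightarrow> real \<Rightarrow> ennreal" where
  "phi_Max \<PP> \<Phi> x = (SUP P\<in>\<PP>. \<Phi> P x)"

definition LPhi_norm ::
  "'a measure set \<Rightarrow> ('a measure \<Rightarrow> real \<Rightarrow> ennreal) \<Rightarrow> ('a \<Rightarrow> real) set \<Rightarrow> ennreal" where
  "LPhi_norm \<PP> \<Phi> X =
     Inf {ennreal l | l. l > 0 \<and> (SUP P\<in>\<PP>. \<integral>\<^sup>+\<omega>. \<Phi> P (inverse l * \<bar>rep X \<omega>\<bar>) \<partial>P) \<le> 1}"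

definition LPhi ::
  "'a measure \<Rightarrow> 'a measure set \<Rightarrow> ('a measure \<Rightarrow> real \<Rightarrow> ennreal) \<Rightarrow> ('a \<Rightarrow> real) set set" where
  "LPhi M \<PP> \<Phi> = {X \<in> L0 M \<PP>. LPhi_norm \<PP> \<Phi> X < \<infinity>}"

definition L1_norm :: "'a measure \<Rightarrow> ('a \<Rightarrow> real) set \<Rightarrow> ennreal" where
  "L1_norm Q X = (\<integral>\<^sup>+\<omega>. ennreal \<bar>rep X \<omega>\<bar> \<partial>Q)"


section \<open>Signed measures\<close>

definition total_variation :: "'a measure \<Rightarrow> ('a set \<Rightarrow> real) \<Rightarrow> 'a set \<Rightarrow> ennreal" where
  "total_variation M \<mu> A =
     (SUP \<D>\<in>{\<D>. finite \<D> \<and> \<D> \<subseteq> sets M \<and> disjoint \<D> \<and> \<Union>\<D> = A}. \<Sum>D\<in>\<D>. ennreal \<bar>\<mu> D\<bar>)"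

definition tv_measure :: "'a measure \<Rightarrow> ('a set \<Rightarrow> real) \<Rightarrow> 'a measure" where
  "tv_measure M \<mu> = measure_of (space M) (sets M) (total_variation M \<mu>)"

text \<open>
  As for \<^const>\<open>measure\<close>, a signed measure is a function on all sets that is \<open>0\<close> on
  non-measurable sets. Countable additivity includes \<open>\<mu> {} = 0\<close>, by the constant sequence
  \<open>{}\<close>.
\<close>

definition ca :: "'a measure \<Rightarrow> ('a set \<Rightarrow> real) set" where
  "ca M = {\<mu>. (\<forall>A::nat \<Rightarrow> 'a set. range A \<subseteq> sets M \<longrightarrow> disjoint_family A \<longrightarrow>
                   (\<lambda>i. \<mu> (A i)) sums \<mu> (\<Union>i. A i)) \<and>
               (\<forall>A. A \<notin> sets M \<longrightarrow> \<mu> A = 0) \<and>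
               total_variation M \<mu> (space M) < \<infinity>}"

definition ca_ac :: "'a measure \<Rightarrow> 'a measure set \<Rightarrow> ('a set \<Rightarrow> real) set" where
  "ca_ac M \<PP> = {\<mu> \<in> ca M. \<forall>N\<in>sets M.
                    (SUP P\<in>\<PP>. emeasure P N) = 0 \<longrightarrow> emeasure (tv_measure M \<mu>) N = 0}"

definition ca_LPhi ::
  "'a measure \<Rightarrow> 'a measure set \<Rightarrow> ('a measure \<Rightarrow> real \<Rightarrow> ennreal) \<Rightarrow> ('a set \<Rightarrow> real) set" where
  "ca_LPhi M \<PP> \<Phi> = {\<mu> \<in> ca_ac M \<PP>.
     (\<forall>X\<in>LPhi M \<PP> \<Phi>. integrable (tv_measure M \<mu>) (rep X)) \<and>
     (\<forall>X\<in>LPhi M \<PP> \<Phi>. \<forall>\<epsilon>>0. \<exists>\<delta>>0. \<forall>Y\<in>LPhi M \<PP> \<Phi>.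
        LPhi_norm \<PP> \<Phi> (qs_minus M \<PP> Y X) < ennreal \<delta> \<longrightarrow>
        \<bar>integral\<^sup>L (tv_measure M \<mu>) (rep Y) - integral\<^sup>L (tv_measure M \<mu>) (rep X)\<bar> < \<epsilon>)}"

text \<open>A probability measure \<open>Q\<close> is viewed as the signed measure \<open>measure Q\<close>.\<close>

definition ca1_LPhi ::
  "'a measure \<Rightarrow> 'a measure set \<Rightarrow> ('a measure \<Rightarrow> real \<Rightarrow> ennreal) \<Rightarrow> 'a measure set" where
  "ca1_LPhi M \<PP> \<Phi> = {Q \<in> prob_measures M. measure Q \<in> ca_LPhi M \<PP> \<Phi>}"


section \<open>Basic facts\<close>

lemma equiv_qs_rel: "equiv (borel_measurable M) (qs_rel M \<PP>)"
proof (rule equivI)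
  show "qs_rel M \<PP> \<subseteq> borel_measurable M \<times> borel_measurable M"
    by (auto simp: qs_rel_def)
  show "refl_on (borel_measurable M) (qs_rel M \<PP>)"
    by (auto simp: qs_rel_def refl_on_def)
  show "sym (qs_rel M \<PP>)"
    by (auto simp: qs_rel_def sym_def eq_commute)
  show "trans (qs_rel M \<PP>)"
  proof (rule transI)
    fix f g h assume fg: "(f, g) \<in> qs_rel M \<PP>" and gh: "(g, h) \<in> qs_rel M \<PP>"
    have "AE \<omega> in P. f \<omega> = h \<omega>" if "P \<in> \<PP>" for P
    proof -
      have "AE \<omega> in P. f \<omega> = g \<omega>" "AE \<omega> in P. g \<omega> = h \<omega>"
        using fg gh that by (auto simp: qs_rel_def)
      then show ?thesis by eventually_elim simp
    qed
    then show "(f, h) \<in> qs_rel M \<PP>"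
      using fg gh by (auto simp: qs_rel_def)
  qed
qed

lemma L0_iff: "X \<in> L0 M \<PP> \<longleftrightarrow> (\<exists>f\<in>borel_measurable M. X = qs_class M \<PP> f)"
  by (auto simp: L0_def quotient_def qs_class_def)

lemma self_in_qs_class: "f \<in> borel_measurable M \<Longrightarrow> f \<in> qs_class M \<PP> f"
  by (auto simp: qs_class_def qs_rel_def)

lemma rep_in_L0: "X \<in> L0 M \<PP> \<Longrightarrow> rep X \<in> X"
  unfolding rep_def L0_iff by (metis self_in_qs_class someI)

lemma rep_qs_class:
  assumes "f \<in> borel_measurable M"
  shows "rep (qs_class M \<PP> f) \<in> borel_measurable M"
    and "P \<in> \<PP> \<Longrightarrow> AE \<omega> in P. rep (qs_class M \<PP> f) \<omega> = f \<omega>"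
proof -
  have "rep (qs_class M \<PP> f) \<in> qs_class M \<PP> f"
    using assms by (intro rep_in_L0) (auto simp: L0_iff)
  then have *: "(f, rep (qs_class M \<PP> f)) \<in> qs_rel M \<PP>"
    by (simp add: qs_class_def)
  then show "rep (qs_class M \<PP> f) \<in> borel_measurable M"
    by (simp add: qs_rel_def)
  show "AE \<omega> in P. rep (qs_class M \<PP> f) \<omega> = f \<omega>" if "P \<in> \<PP>"
    using * that by (auto simp: qs_rel_def eq_commute)
qed

lemma LPhi_norm_qs_class:
  assumes "f \<in> borel_measurable M"
  shows "LPhi_norm \<PP> \<Phi> (qs_class M \<PP> f) =
     Inf {ennreal l | l. l > 0 \<and> (SUP P\<in>\<PP>. \<integral>\<^sup>+\<omega>. \<Phi> P (inverse l * \<bar>f \<omega>\<bar>) \<partial>P) \<le> 1}"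
proof -
  have "(\<integral>\<^sup>+\<omega>. \<Phi> P (inverse l * \<bar>rep (qs_class M \<PP> f) \<omega>\<bar>) \<partial>P) =
        (\<integral>\<^sup>+\<omega>. \<Phi> P (inverse l * \<bar>f \<omega>\<bar>) \<partial>P)" if "P \<in> \<PP>" for P l
    by (rule nn_integral_cong_AE, use rep_qs_class(2)[OF assms that] in eventually_elim) simp
  then show ?thesis
    unfolding LPhi_norm_def by simp
qed

lemma Linf_norm_qs_class:
  assumes "f \<in> borel_measurable M"
  shows "Linf_norm M \<PP> (qs_class M \<PP> f) =
     Inf {ennreal m | m. m > 0 \<and> (\<forall>P\<in>\<PP>. AE \<omega> in P. \<bar>f \<omega>\<bar> \<le> m)}"
proof -
  have "qs_le \<PP> (qs_abs M \<PP> (qs_class M \<PP> f)) (qs_class M \<PP> (\<lambda>_. m)) \<longleftrightarrow>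
        (\<forall>P\<in>\<PP>. AE \<omega> in P. \<bar>f \<omega>\<bar> \<le> m)" for m
  proof safe
    fix P assume le: "qs_le \<PP> (qs_abs M \<PP> (qs_class M \<PP> f)) (qs_class M \<PP> (\<lambda>_. m))"
      and P: "P \<in> \<PP>"
    have 1: "(\<lambda>\<omega>. \<bar>rep (qs_class M \<PP> f) \<omega>\<bar>) \<in> qs_abs M \<PP> (qs_class M \<PP> f)"
      unfolding qs_abs_def by (intro self_in_qs_class borel_measurable_abs rep_qs_class(1) assms)
    have 2: "(\<lambda>_. m) \<in> qs_class M \<PP> (\<lambda>_. m)"
      by (simp add: self_in_qs_class)
    have "AE \<omega> in P. \<bar>rep (qs_class M \<PP> f) \<omega>\<bar> \<le> m"
      using le[unfolded qs_le_def, rule_format, OF 1 2 P] .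
    with rep_qs_class(2)[OF assms P] show "AE \<omega> in P. \<bar>f \<omega>\<bar> \<le> m"
      by eventually_elim simp
  next
    assume bd: "\<forall>P\<in>\<PP>. AE \<omega> in P. \<bar>f \<omega>\<bar> \<le> m"
    show "qs_le \<PP> (qs_abs M \<PP> (qs_class M \<PP> f)) (qs_class M \<PP> (\<lambda>_. m))"
      unfolding qs_le_def
    proof safe
      fix g h P assume "g \<in> qs_abs M \<PP> (qs_class M \<PP> f)" "h \<in> qs_class M \<PP> (\<lambda>_. m)"
        and P: "P \<in> \<PP>"
      then have "AE \<omega> in P. \<bar>rep (qs_class M \<PP> f) \<omega>\<bar> = g \<omega>" "AE \<omega> in P. m = h \<omega>"
        by (auto simp: qs_abs_def qs_class_def qs_rel_def)
      moreover have "AE \<omega> in P. \<bar>f \<omega>\<bar> \<le> m" using bd P by simp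
      ultimately show "AE \<omega> in P. g \<omega> \<le> h \<omega>"
        using rep_qs_class(2)[OF assms P] by eventually_elim simp
    qed
  qed
  then show ?thesis
    unfolding Linf_norm_def by simp
qed

lemma tv_measure_prob:
  assumes "Q \<in> prob_measures M"
  shows "tv_measure M (measure Q) = Q"
proof -
  interpret prob_space Q using assms by (simp add: prob_measures_def)
  have sets: "sets Q = sets M" using assms by (simp add: prob_measures_def)
  have eq: "total_variation M (measure Q) A = emeasure Q A" if A: "A \<in> sets M" for A
  proof -
    have val: "(\<Sum>D\<in>\<D>. ennreal \<bar>measure Q D\<bar>) = emeasure Q A"
      if "finite \<D>" "\<D> \<subseteq> sets M" "disjoint \<D>" "\<Union>\<D> = A" for \<D>
    proof -
      have "(\<Sum>D\<in>\<D>. ennreal \<bar>measure Q D\<bar>) = (\<Sum>D\<in>\<D>. emeasure Q (id D))"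
        by (simp add: emeasure_eq_measure)
      also have "\<dots> = emeasure Q (\<Union>D\<in>\<D>. id D)"
        using that sets by (intro sum_emeasure) (auto simp: disjoint_family_on_def disjoint_def)
      finally show ?thesis using that by simp
    qed
    have ne: "{A} \<in> {\<D>. finite \<D> \<and> \<D> \<subseteq> sets M \<and> disjoint \<D> \<and> \<Union>\<D> = A}"
      using A by (auto simp: disjoint_def)
    show ?thesis
      unfolding total_variation_def
    proof (rule antisym)
      show "(SUP \<D>\<in>{\<D>. finite \<D> \<and> \<D> \<subseteq> sets M \<and> disjoint \<D> \<and> \<Union>\<D> = A}.
              \<Sum>D\<in>\<D>. ennreal \<bar>measure Q D\<bar>) \<le> emeasure Q A"
        by (rule SUP_least) (use val in auto)
      show "emeasure Q A \<le> (SUP \<D>\<in>{\<D>. finite \<D> \<and> \<D> \<subseteq> sets M \<and> disjoint \<D> \<and> \<Union>\<D> = A}.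
              \<Sum>D\<in>\<D>. ennreal \<bar>measure Q D\<bar>)"
        by (rule SUP_upper2[OF ne]) (simp add: emeasure_eq_measure)
    qed
  qed
  have "tv_measure M (measure Q) = measure_of (space M) (sets M) (emeasure Q)"
    unfolding tv_measure_def
    by (rule measure_of_eq) (use eq sets.space_closed in \<open>auto simp: sets.sigma_sets_eq\<close>)
  also have "\<dots> = Q"
    using measure_of_of_measure[of Q] sets sets_eq_imp_space_eq[OF sets] by simp
  finally show ?thesis .
qed

lemma L1_norm_qs_class:
  assumes f: "f \<in> borel_measurable M" and Q: "Q \<in> prob_measures M" "measure Q \<in> ca_ac M \<PP>"
    and \<PP>: "\<PP> \<subseteq> prob_measures M"
  shows "L1_norm Q (qs_class M \<PP> f) = (\<integral>\<^sup>+\<omega>. ennreal \<bar>f \<omega>\<bar> \<partial>Q)"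
proof -
  let ?g = "rep (qs_class M \<PP> f)"
  let ?N = "{\<omega> \<in> space M. ?g \<omega> \<noteq> f \<omega>}"
  have N: "?N \<in> sets M"
    using f rep_qs_class(1)[OF f, of \<PP>] by measurable
  have "emeasure P ?N = 0" if P: "P \<in> \<PP>" for P
  proof -
    have "sets P = sets M" using P \<PP> by (auto simp: prob_measures_def)
    then show ?thesis
      using rep_qs_class(2)[OF f P] N sets_eq_imp_space_eq[of P M]
      by (subst (asm) AE_iff_measurable[OF _ refl]) auto
  qed
  then have "(SUP P\<in>\<PP>. emeasure P ?N) = 0"
    by (simp add: SUP_eq_iff bot_ennreal[symmetric] SUP_bot_conv)
  then have "emeasure Q ?N = 0"
    using Q N tv_measure_prob[OF Q(1)] unfolding ca_ac_def by auto
  moreover have "sets Q = sets M" using Q by (auto simp: prob_measures_def)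
  ultimately have "AE \<omega> in Q. ?g \<omega> = f \<omega>"
    using N sets_eq_imp_space_eq[of Q M] by (intro AE_I[of _ _ ?N]) auto
  then show ?thesis
    unfolding L1_norm_def by (intro nn_integral_cong_AE) (auto elim: eventually_mono)
qed

end

theory Submission
  imports Defs
begin

text \<open>
  The core is the dual representation of the norm when \<open>\<phi>_Max\<close> is finite somewhere. An Orlicz
  function \<open>\<phi>\<close> is the supremum of countably many lines \<open>u \<mapsto> a * u - b\<close> with \<open>a, b \<ge> 0\<close>. If
  \<open>E\<^sub>P \<phi>\<^sub>P(|X| / l) > 1\<close>, then by monotone convergence finitely many of these lines already give
  an expectation above 1. Choosing at each point the largest of them yields bounded slopes \<open>Y\<close>
  and offsets \<open>B\<close> with \<open>E\<^sub>P(Y |X|) > l (1 + E\<^sub>P B)\<close>, whereas \<open>E\<^sub>P(Y |Z|) \<le> (1 + E\<^sub>P B) \<parallel>Z\<parallel>\<close> for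
  every \<open>Z\<close>. Normalizing \<open>Y dP\<close> to a probability measure \<open>Q\<close> gives a weighted \<open>L\<^sup>1\<close>-norm below the
  Luxemburg norm that is at least \<open>l\<close> at \<open>X\<close>. As the same \<open>Q\<close> may come from several pairs
  \<open>(P, Y)\<close>, its weight is the largest admissible one; evaluating at \<open>X = 1\<close> bounds the weights.
\<close>

section \<open>Affine minorants of an Orlicz function\<close>

text \<open>A supporting line argument at a point \<open>(x, r)\<close> strictly below the graph, so
  that \<open>\<phi> x = \<infinity>\<close> needs no separate treatment. The slope is the least one
  that keeps the line below the graph to the left of \<open>x\<close>; convexity then keeps it below
  to the right.\<close>

lemma Orlicz_affine_minorant:
  assumes "Orlicz_function \<phi>" "0 \<le> x" "0 \<le> r" "ennreal r < \<phi> x"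
  obtains a b where "0 \<le> a" "0 \<le> b" "a * x - b = r" "\<And>u. 0 \<le> u \<Longrightarrow> ennreal (a * u - b) \<le> \<phi> u"
proof -
  have lsc: "\<phi> x \<le> Liminf (at x within {0..}) \<phi>" and mono: "mono_on {0..} \<phi>"
    and conv: "convex_nonneg \<phi>" and [simp]: "\<phi> 0 = 0"
    using assms by (auto simp: Orlicz_function_def lsc_nonneg_def)
  have "0 < x" using assms by (cases "x = 0") auto
  have "\<forall>\<^sub>F u in at x within {0..}. ennreal r < \<phi> u"
    using less_LiminfD[OF order.strict_trans2[OF assms(4) lsc]] .
  then obtain d where d: "d > 0" "\<And>u. u \<ge> 0 \<Longrightarrow> u \<noteq> x \<Longrightarrow> dist u x < d \<Longrightarrow> ennreal r < \<phi> u"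
    unfolding eventually_at by auto
  \<comment> \<open>The point \<open>z\<close> is nonnegative, left of \<open>x\<close> and closer
    to it than \<open>d\<close>, so lower semicontinuity gives \<open>\<phi> z > r\<close>. By
    monotonicity the set \<open>S\<close> below then stays left of \<open>z\<close>, and the
    quotients \<open>g u\<close> are bounded by \<open>r / (x - z)\<close>.\<close>
  define z where "z = max (x / 2) (x - d / 2)"
  have z: "0 \<le> z" "z < x" using \<open>0 < x\<close> d by (auto simp: z_def max_def)
  have rz: "ennreal r < \<phi> z"
    using d \<open>0 < x\<close> by (intro d(2)) (auto simp: z_def dist_real_def max_def)
  \<comment> \<open>Left of \<open>x\<close> a line through \<open>(x, r)\<close> with nonnegative
    slope has values at most \<open>r\<close>, so only points with \<open>\<phi> u \<le> r\<close>
    constrain the slope; \<open>g u\<close> is the constraint from \<open>u\<close>.\<close>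
  define S where "S = {u. 0 \<le> u \<and> u < x \<and> \<phi> u \<le> ennreal r}"
  define g where "g u = (r - enn2real (\<phi> u)) / (x - u)" for u
  have "0 \<in> S" using \<open>0 < x\<close> by (auto simp: S_def)
  have Sz: "u < z" if "u \<in> S" for u
  proof (rule ccontr)
    assume "\<not> u < z"
    then have "\<phi> z \<le> \<phi> u" using z that by (intro mono_onD[OF mono]) (auto simp: S_def)
    then show False using rz that by (auto simp: S_def)
  qed
  have bdd: "bdd_above (g ` S)"
  proof (rule bdd_aboveI2)
    fix u assume "u \<in> S"
    then have "u < z" by (rule Sz)
    have "(r - enn2real (\<phi> u)) / (x - u) \<le> r / (x - z)"
      using \<open>u < z\<close> z assms by (intro frac_le) auto
    then show "g u \<le> r / (x - z)" by (simp add: g_def)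
  qed
  define a where "a = Sup (g ` S)"
  have ga: "g u \<le> a" if "u \<in> S" for u
    unfolding a_def using that bdd by (intro cSup_upper) auto
  \<comment> \<open>The constraint from \<open>u = 0\<close>, where \<open>\<phi>\<close> vanishes,
    yields both \<open>a \<ge> 0\<close> and a nonnegative offset \<open>a * x - r\<close>.\<close>
  have a: "a \<ge> r / x" using ga[OF \<open>0 \<in> S\<close>] by (simp add: g_def)
  show thesis
  proof (rule that[of a "a * x - r"])
    show "0 \<le> a" using a \<open>0 < x\<close> assms by (meson divide_nonneg_pos order_trans)
    show "0 \<le> a * x - r" using a \<open>0 < x\<close> by (simp add: field_simps)
    show "a * x - (a * x - r) = r" by simp
    fix u :: real assume u: "0 \<le> u"
    consider "u \<in> S" | "u < x" "ennreal r < \<phi> u" | "u = x" | "x < u"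
      using u by (force simp: S_def)
    then show "ennreal (a * u - (a * x - r)) \<le> \<phi> u"
    proof cases
      case 1
      then have "u < x" and fin: "\<phi> u < \<infinity>" by (auto simp: S_def intro: le_less_trans)
      have "r - enn2real (\<phi> u) \<le> a * (x - u)"
        using ga[OF 1] \<open>u < x\<close> by (simp add: g_def pos_divide_le_eq)
      then have "ennreal (a * u - (a * x - r)) \<le> ennreal (enn2real (\<phi> u))"
        by (intro ennreal_leI) (simp add: algebra_simps)
      also have "\<dots> = \<phi> u" using fin by (intro ennreal_enn2real) simp
      finally show ?thesis .
    next
      case 2
      have "a * (x - u) \<ge> 0" using 2 \<open>0 \<le> a\<close> by simp
      then have "ennreal (a * u - (a * x - r)) \<le> ennreal r"
        by (intro ennreal_leI) (simp add: algebra_simps)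
      then show ?thesis using 2 by simp
    next
      case 3
      then show ?thesis using assms by simp
    next
      case 4
      show ?thesis
      proof (cases "\<phi> u = \<infinity>")
        case False
        then obtain p where p: "\<phi> u = ennreal p" "p \<ge> 0" by (cases "\<phi> u") auto
        have "a \<le> (p - r) / (u - x)"
          unfolding a_def
        proof (rule cSup_least)
          show "g ` S \<noteq> {}" using \<open>0 \<in> S\<close> by auto
          fix y assume "y \<in> g ` S"
          then obtain v where v: "v \<in> S" "y = g v" by auto
          then have vx: "0 \<le> v" "v < x" by (auto simp: S_def)
          obtain q where q: "\<phi> v = ennreal q" "q \<ge> 0"
            using v by (cases "\<phi> v") (auto simp: S_def top_unique)
          \<comment> \<open>With this \<open>t\<close>, \<open>x\<close> is a convex combination of
            \<open>v\<close> and \<open>u\<close>. Since \<open>r < \<phi> x\<close>, convexity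
            shows that the slope from \<open>v\<close> to \<open>(x, r)\<close> is at most the slope
            from \<open>(x, r)\<close> to \<open>u\<close>.\<close>
          define t where "t = (x - v) / (u - v)"
          have tuv: "t * (u - v) = x - v" using vx 4 by (simp add: t_def)
          have t: "t \<in> {0..1}" using vx 4 by (auto simp: t_def)
          have tx: "(1 - t) * v + t * u = x" using tuv by (simp add: algebra_simps)
          have "\<phi> ((1 - t) * v + t * u) \<le> ennreal (1 - t) * \<phi> v + ennreal t * \<phi> u"
            using conv vx u t unfolding convex_nonneg_def by blast
          also have "\<dots> = ennreal ((1 - t) * q + t * p)"
            using p q t by (simp add: ennreal_mult ennreal_plus)
          finally have "ennreal r < ennreal ((1 - t) * q + t * p)"
            using assms tx by auto
          then have "r < (1 - t) * q + t * p"
            using assms(3) ennreal_less_iff by blast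
          then have "r * (u - v) < ((1 - t) * q + t * p) * (u - v)"
            using vx 4 by simp
          also have "\<dots> = q * (u - v) + t * (u - v) * (p - q)"
            by (simp add: algebra_simps)
          also have "\<dots> = (u - x) * q + (x - v) * p"
            unfolding tuv by (simp add: algebra_simps)
          finally have "(r - q) * (u - x) \<le> (p - r) * (x - v)" by (simp add: algebra_simps)
          then show "y \<le> (p - r) / (u - x)"
            using v vx 4 q by (simp add: g_def pos_le_divide_eq pos_divide_le_eq)
        qed
        then have "a * (u - x) \<le> p - r" using 4 by (simp add: pos_le_divide_eq)
        then show ?thesis unfolding p by (intro ennreal_leI) (simp add: algebra_simps)
      qed simp
    qed
  qed
qed

text \<open>Lowering the slope and raising the offset of a minorant keeps it a minorant on
  \<open>[0, \<infinity>)\<close>. Starting from a line through \<open>(x, s)\<close> with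
  \<open>r < s < \<phi> x\<close> leaves room to make both coefficients rational.\<close>

lemma Orlicz_rational_affine_minorant:
  assumes "Orlicz_function \<phi>" "0 \<le> x" "0 \<le> r" "ennreal r < \<phi> x"
  obtains a b where "a \<in> \<rat>" "b \<in> \<rat>" "0 < a" "0 \<le> b" "r < a * x - b"
    "\<And>u. 0 \<le> u \<Longrightarrow> ennreal (a * u - b) \<le> \<phi> u"
proof -
  obtain s where s: "r < s" "ennreal s < \<phi> x"
    using assms(3,4) by (cases "\<phi> x") (metis dense ennreal_less_iff order_less_imp_le order_trans,
      metis ennreal_less_top infinity_ennreal_def less_add_one)
  obtain a b where ab: "0 \<le> a" "0 \<le> b" "a * x - b = s"
      "\<And>u. 0 \<le> u \<Longrightarrow> ennreal (a * u - b) \<le> \<phi> u"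
    using Orlicz_affine_minorant[OF assms(1,2) _ s(2)] s assms by (metis less_eq_real_def order_trans)
  \<comment> \<open>Here \<open>a * x = s + b\<close> with \<open>s > r \<ge> 0\<close>; so
    \<open>a > 0\<close>, which leaves room for a smaller positive rational slope.\<close>
  have pos: "a * x > 0" using ab s assms by linarith
  then have "x > 0" "a > 0" using ab assms by (auto simp: zero_less_mult_iff)
  \<comment> \<open>Half the gap for each change: at \<open>x\<close>, the new slope and the new
    offset each cost less than \<open>e\<close>.\<close>
  define e where "e = (s - r) / 2"
  have "e > 0" using s by (simp add: e_def)
  obtain a' where a': "a' \<in> \<rat>" "max 0 (a - e / x) < a'" "a' < a"
    using Rats_dense_in_real[of "max 0 (a - e / x)" a] \<open>a > 0\<close> \<open>e > 0\<close> \<open>x > 0\<close> by auto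
  obtain b' where b': "b' \<in> \<rat>" "b < b'" "b' < b + e"
    using Rats_dense_in_real[of b "b + e"] \<open>e > 0\<close> by auto
  show thesis
  proof (rule that[of a' b'])
    have "(a - a') * x < e" using a' \<open>x > 0\<close> by (simp add: field_simps)
    then show "r < a' * x - b'" using ab(3) b' by (simp add: e_def left_diff_distrib field_simps)
    fix u :: real assume u: "0 \<le> u"
    have "a' * u - b' \<le> a * u - b" using u a' b' by (simp add: mult_right_mono diff_mono)
    then show "ennreal (a' * u - b') \<le> \<phi> u" using ab(4)[OF u] ennreal_leI order_trans by blast
  qed (use a' b' ab in auto)
qed

text \<open>Among the first \<open>n\<close> lines of an enumeration of the rational minorants, the
  best one at \<open>x\<close> has slope \<open>Y n x\<close> and offset \<open>B n x\<close>. As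
  functions of \<open>x\<close> these take finitely many values, hence are bounded. The line chosen
  at \<open>x\<close> minorizes \<open>\<phi>\<close> at every \<open>u\<close>, which Young's
  inequality requires.\<close>

lemma Orlicz_maximizing_lines:
  assumes "Orlicz_function \<phi>"
  obtains Y B :: "nat \<Rightarrow> real \<Rightarrow> real" where
    "\<And>n. Y n \<in> borel_measurable borel" "\<And>n. B n \<in> borel_measurable borel"
    "\<And>n x. 0 \<le> Y n x" "\<And>n x. 0 \<le> B n x"
    "\<And>n. \<exists>K. \<forall>x. Y n x \<le> K \<and> B n x \<le> K"
    "\<And>n x u. 0 \<le> u \<Longrightarrow> ennreal (Y n x * u - B n x) \<le> \<phi> u"
    "\<And>x. incseq (\<lambda>n. Y n x * x - B n x)" "\<And>n x. 0 \<le> Y n x * x - B n x"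
    "\<And>x. 0 \<le> x \<Longrightarrow> (SUP n. ennreal (Y n x * x - B n x)) = \<phi> x"
proof -
  define D where "D = {(a, b) \<in> \<rat> \<times> \<rat>. 0 \<le> a \<and> 0 \<le> b \<and>
    (\<forall>u\<ge>0. ennreal (a * u - b) \<le> \<phi> u)}"
  have "countable D"
    by (rule countable_subset[of _ "\<rat> \<times> \<rat>"]) (auto simp: D_def countable_rat)
  have D0: "(0, 0) \<in> D" by (auto simp: D_def)
  define e where "e = from_nat_into D"
  have eD: "e n \<in> D" for n unfolding e_def using D0 by (intro from_nat_into) auto
  define v :: "real \<times> real \<Rightarrow> real \<Rightarrow> real" where "v p x = fst p * x - snd p" for p x
  \<comment> \<open>A running maximizer at \<open>x\<close>. The zero line as start makes all
    selected values nonnegative, and \<open>p (Suc n)\<close> is the first stage that has seen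
    \<open>e n\<close>.\<close>
  define p where "p n x = rec_nat (0, 0) (\<lambda>n q. if v q x < v (e n) x then e n else q) n" for n x
  have p0: "p 0 x = (0, 0)" for x by (simp add: p_def)
  have pS: "p (Suc n) x = (if v (p n x) x < v (e n) x then e n else p n x)" for n x
    by (simp add: p_def)
  have pD: "p n x \<in> D" for n x by (induction n) (auto simp: p0 pS D0 eD)
  have inc: "incseq (\<lambda>n. v (p n x) x)" for x by (rule incseq_SucI) (simp add: pS)
  have ge: "v (e n) x \<le> v (p (Suc n) x) x" for n x by (simp add: pS)
  have meas: "(\<lambda>x. fst (p n x)) \<in> borel_measurable borel \<and>
      (\<lambda>x. snd (p n x)) \<in> borel_measurable borel" for n
  proof (induction n)
    case (Suc n)
    then have [measurable]: "(\<lambda>x. fst (p n x)) \<in> borel_measurable borel"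
        "(\<lambda>x. snd (p n x)) \<in> borel_measurable borel" by auto
    show ?case unfolding pS v_def if_distrib by measurable
  qed (simp add: p0)
  have bd: "\<exists>K. \<forall>x. fst (p n x) \<le> K \<and> snd (p n x) \<le> K" for n
  proof (induction n)
    case (Suc n)
    then obtain K where "\<forall>x. fst (p n x) \<le> K \<and> snd (p n x) \<le> K" by blast
    then show ?case
      by (intro exI[of _ "max K (max (fst (e n)) (snd (e n)))"])
        (auto simp: pS intro: max.coboundedI1 max.coboundedI2)
  qed (auto simp: p0)
  have minor: "ennreal (fst (p n x) * u - snd (p n x)) \<le> \<phi> u" if "0 \<le> u" for n x u
    using pD[of n x] that by (auto simp: D_def split: prod.splits)
  have nonneg: "0 \<le> v (p n x) x" for n x
    using incseqD[OF inc, of 0 n x] by (simp add: p0 v_def)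
  show thesis
  proof (rule that[of "\<lambda>n x. fst (p n x)" "\<lambda>n x. snd (p n x)"])
    fix x :: real assume x: "0 \<le> x"
    show "(SUP n. ennreal (fst (p n x) * x - snd (p n x))) = \<phi> x"
    proof (rule antisym)
      show "(SUP n. ennreal (fst (p n x) * x - snd (p n x))) \<le> \<phi> x"
        by (intro SUP_least minor x)
      show "\<phi> x \<le> (SUP n. ennreal (fst (p n x) * x - snd (p n x)))"
      proof (rule ccontr)
        \<comment> \<open>A supremum below \<open>\<phi> x\<close> is a finite \<open>r\<close>;
          some rational minorant exceeds \<open>r\<close> at \<open>x\<close>, and it is beaten by
          the running maximizer once it has been enumerated.\<close>
        assume "\<not> ?thesis"
        then have lt: "(SUP n. ennreal (fst (p n x) * x - snd (p n x))) < \<phi> x" by simp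
        then obtain r where r: "(SUP n. ennreal (fst (p n x) * x - snd (p n x))) = ennreal r" "0 \<le> r"
          by (cases "SUP n. ennreal (fst (p n x) * x - snd (p n x))") auto
        have "ennreal r < \<phi> x" using lt r by simp
        then obtain a b where ab: "a \<in> \<rat>" "b \<in> \<rat>" "0 < a" "0 \<le> b" "r < a * x - b"
            "\<And>u. 0 \<le> u \<Longrightarrow> ennreal (a * u - b) \<le> \<phi> u"
          using Orlicz_rational_affine_minorant[OF assms x r(2)] by blast
        then have "(a, b) \<in> D" by (auto simp: D_def)
        then obtain n where n: "e n = (a, b)"
          unfolding e_def using from_nat_into_surj[OF \<open>countable D\<close>] by blast
        have "a * x - b \<le> v (p (Suc n) x) x" using ge[of n x] n by (simp add: v_def)
        with ab have "r < v (p (Suc n) x) x" by linarith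
        moreover have "ennreal (v (p (Suc n) x) x) \<le> ennreal r"
          unfolding r(1)[symmetric] v_def by (rule SUP_upper) simp
        ultimately show False using r nonneg by (simp add: ennreal_le_iff)
      qed
    qed
  next
    show "0 \<le> fst (p n x)" "0 \<le> snd (p n x)" for n x
      using pD[of n x] by (simp_all add: D_def split_beta)
  qed (use meas bd minor inc nonneg in \<open>simp_all add: v_def\<close>)
qed

text \<open>A strictly positive slope is available because \<open>\<phi>\<close> is positive
  somewhere. This is what later places every \<open>P\<close> in \<open>\<PP>\<close> among the dual
  probability measures.\<close>

lemma Orlicz_affine_lower_bound:
  assumes "Orlicz_function \<phi>"
  obtains a b where "0 < a" "0 \<le> b" "\<And>u. 0 \<le> u \<Longrightarrow> ennreal (a * u - b) \<le> \<phi> u"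
proof -
  obtain x where "0 < x" "ennreal 0 < \<phi> x"
    using assms by (auto simp: Orlicz_function_def)
  then show thesis
    using Orlicz_rational_affine_minorant[OF assms, of x 0] that by (metis order_refl less_imp_le)
qed

text \<open>The maximizing lines exhibit \<open>\<phi>\<close> as a countable supremum of Borel
  functions.\<close>

lemma borel_measurable_Orlicz:
  assumes "Orlicz_function \<phi>" and [measurable]: "g \<in> borel_measurable N" and "\<And>\<omega>. 0 \<le> g \<omega>"
  shows "(\<lambda>\<omega>. \<phi> (g \<omega>)) \<in> borel_measurable N"
proof (rule Orlicz_maximizing_lines[OF assms(1)])
  fix Y B :: "nat \<Rightarrow> real \<Rightarrow> real"
  assume [measurable]: "\<And>n. Y n \<in> borel_measurable borel" "\<And>n. B n \<in> borel_measurable borel"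
    and eq: "\<And>x. 0 \<le> x \<Longrightarrow> (SUP n. ennreal (Y n x * x - B n x)) = \<phi> x"
  have "(\<lambda>\<omega>. SUP n. ennreal (Y n (g \<omega>) * g \<omega> - B n (g \<omega>))) \<in> borel_measurable N"
    by measurable
  then show "(\<lambda>\<omega>. \<phi> (g \<omega>)) \<in> borel_measurable N" using eq assms(3) by simp
qed

section \<open>The supremum of a family of Orlicz functions\<close>

text \<open>Every defining property except finiteness at some positive point passes to pointwise
  suprema.\<close>

lemma Orlicz_phi_Max_iff:
  assumes "\<PP> \<noteq> {}" "\<And>P. P \<in> \<PP> \<Longrightarrow> Orlicz_function (\<Phi> P)"
  shows "Orlicz_function (phi_Max \<PP> \<Phi>) \<longleftrightarrow> (\<exists>x0>0. phi_Max \<PP> \<Phi> x0 < \<infinity>)"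
proof -
  have "lsc_nonneg (phi_Max \<PP> \<Phi>)"
    unfolding lsc_nonneg_def phi_Max_def
  proof (intro allI impI SUP_least)
    fix x :: real and P assume "0 \<le> x" "P \<in> \<PP>"
    then have "\<Phi> P x \<le> Liminf (at x within {0..}) (\<Phi> P)"
      using assms by (auto simp: Orlicz_function_def lsc_nonneg_def)
    also have "\<dots> \<le> Liminf (at x within {0..}) (\<lambda>x. SUP P\<in>\<PP>. \<Phi> P x)"
      using \<open>P \<in> \<PP>\<close> by (intro Liminf_mono always_eventually allI SUP_upper)
    finally show "\<Phi> P x \<le> \<dots>" .
  qed
  moreover have "mono_on {0..} (phi_Max \<PP> \<Phi>)"
    unfolding phi_Max_def
  proof (intro mono_onI SUP_subset_mono order_refl)
    fix x y :: real and P assume "x \<in> {0..}" "y \<in> {0..}" "x \<le> y" "P \<in> \<PP>"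
    then show "\<Phi> P x \<le> \<Phi> P y"
      using assms(2)[of P] mono_onD[of "{0..}" "\<Phi> P" x y] by (simp add: Orlicz_function_def)
  qed
  moreover have "convex_nonneg (phi_Max \<PP> \<Phi>)"
    unfolding convex_nonneg_def phi_Max_def
  proof (intro allI impI ballI SUP_least)
    fix x y t :: real and P assume *: "0 \<le> x" "0 \<le> y" "t \<in> {0..1}" "P \<in> \<PP>"
    then have "\<Phi> P ((1 - t) * x + t * y) \<le> ennreal (1 - t) * \<Phi> P x + ennreal t * \<Phi> P y"
      using assms by (auto simp: Orlicz_function_def convex_nonneg_def)
    also have "\<dots> \<le> ennreal (1 - t) * (SUP P\<in>\<PP>. \<Phi> P x) + ennreal t * (SUP P\<in>\<PP>. \<Phi> P y)"
      using * by (intro add_mono mult_left_mono SUP_upper) auto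
    finally show "\<Phi> P ((1 - t) * x + t * y) \<le> \<dots>" .
  qed
  moreover have "phi_Max \<PP> \<Phi> 0 = 0"
    using assms by (auto simp: phi_Max_def Orlicz_function_def intro!: SUP_eq_const)
  moreover obtain P where "P \<in> \<PP>" using assms by blast
  then obtain x1 where "0 < x1" "0 < \<Phi> P x1" using assms by (auto simp: Orlicz_function_def)
  then have "\<exists>x1>0. 0 < phi_Max \<PP> \<Phi> x1"
    unfolding phi_Max_def using \<open>P \<in> \<PP>\<close> by (meson SUP_upper less_le_trans)
  ultimately show ?thesis by (auto simp: Orlicz_function_def)
qed

section \<open>Probability measures as signed measures\<close>

text \<open>For a probability measure, the sum over a finite partition is the measure of the union,
  so the total variation is at most 1; and since \<open>tv_measure\<close> returns \<open>Q\<close>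
  itself, absolute continuity can be tested on \<open>Q\<close>.\<close>

lemma prob_in_ca_ac:
  assumes Q: "Q \<in> prob_measures M"
    and ac: "\<And>N. N \<in> sets M \<Longrightarrow> (\<And>P. P \<in> \<PP> \<Longrightarrow> emeasure P N = 0) \<Longrightarrow> emeasure Q N = 0"
  shows "measure Q \<in> ca_ac M \<PP>"
proof -
  interpret prob_space Q using Q by (simp add: prob_measures_def)
  have sets: "sets Q = sets M" using Q by (simp add: prob_measures_def)
  have "(\<Sum>D\<in>\<D>. ennreal \<bar>measure Q D\<bar>) \<le> 1"
    if "finite \<D>" "\<D> \<subseteq> sets M" "disjoint \<D>" for \<D>
  proof -
    have "(\<Sum>D\<in>\<D>. ennreal \<bar>measure Q D\<bar>) = (\<Sum>D\<in>\<D>. emeasure Q (id D))"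
      by (simp add: emeasure_eq_measure)
    also have "\<dots> = emeasure Q (\<Union>D\<in>\<D>. id D)"
      using that sets by (intro sum_emeasure) (auto simp: disjoint_family_on_def disjoint_def)
    finally show ?thesis by (simp add: emeasure_le_1)
  qed
  then have "total_variation M (measure Q) (space M) \<le> 1"
    unfolding total_variation_def by (intro SUP_least) auto
  then have "total_variation M (measure Q) (space M) < \<infinity>"
    using ennreal_one_less_top by (metis infinity_ennreal_def order.strict_trans1)
  moreover have "(\<lambda>i. measure Q (A i)) sums measure Q (\<Union>i. A i)"
    if "range A \<subseteq> sets M" "disjoint_family A" for A :: "nat \<Rightarrow> _"
    using that sets by (intro finite_measure_UNION) auto
  moreover have "measure Q A = 0" if "A \<notin> sets M" for A
    using that sets by (simp add: measure_notin_sets)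
  ultimately have "measure Q \<in> ca M" by (auto simp: ca_def)
  then show ?thesis
    using ac by (auto simp: ca_ac_def tv_measure_prob[OF Q] bot_ennreal[symmetric] SUP_bot_conv)
qed

lemma rep_measurable: "X \<in> L0 M \<PP> \<Longrightarrow> rep X \<in> borel_measurable M"
  by (auto simp: L0_iff rep_qs_class)

section \<open>Dual probability measures and their weights\<close>

locale robust_Orlicz =
  fixes M :: "'a measure" and \<PP> :: "'a measure set" and \<Phi> :: "'a measure \<Rightarrow> real \<Rightarrow> ennreal"
  assumes nonempty: "\<PP> \<noteq> {}"
    and prob_measures: "\<PP> \<subseteq> prob_measures M"
    and Orlicz: "\<And>P. P \<in> \<PP> \<Longrightarrow> Orlicz_function (\<Phi> P)"
begin

lemma prob_space_PP: "P \<in> \<PP> \<Longrightarrow> prob_space P"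
  and sets_PP: "P \<in> \<PP> \<Longrightarrow> sets P = sets M"
  using prob_measures by (auto simp: prob_measures_def)

lemma rep_measurable_PP: "X \<in> L0 M \<PP> \<Longrightarrow> P \<in> \<PP> \<Longrightarrow> rep X \<in> borel_measurable P"
  using rep_measurable[of X M \<PP>] measurable_cong_sets[OF sets_PP refl] by blast

text \<open>The reciprocals of these numbers are the positive bounds of
  \<open>X \<mapsto> E_Q |X|\<close> in the Luxemburg norm; the supremum of the set becomes the
  weight of \<open>Q\<close>.\<close>

definition dual_weights :: "'a measure \<Rightarrow> real set" where
  "dual_weights Q = {c. 0 < c \<and> (\<forall>X\<in>L0 M \<PP>. ennreal c * L1_norm Q X \<le> LPhi_norm \<PP> \<Phi> X)}"

text \<open>All measures with an admissible weight are collected, not only the densities constructed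
  below. One half of the norm formula then holds by definition, and a construction is needed only
  for reaching the norm.\<close>

definition dual_probs :: "'a measure set" where
  "dual_probs = {Q \<in> prob_measures M. measure Q \<in> ca_ac M \<PP> \<and> dual_weights Q \<noteq> {}}"

text \<open>A weight \<open>c\<close> gives
  \<open>E_Q |X| \<le> \<parallel>X\<parallel> / c\<close>. This yields integrability on the Orlicz
  space and Lipschitz continuity with constant \<open>1 / c\<close>, whence
  \<open>\<delta> = c * \<epsilon>\<close>.\<close>

lemma dual_probs_subset_ca1: "dual_probs \<subseteq> ca1_LPhi M \<PP> \<Phi>"
proof
  fix Q assume Q: "Q \<in> dual_probs"
  then have prob: "Q \<in> prob_measures M" and ac: "measure Q \<in> ca_ac M \<PP>" by (auto simp: dual_probs_def)
  have sets: "sets Q = sets M" using prob by (simp add: prob_measures_def)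
  obtain c where c: "0 < c" "\<And>X. X \<in> L0 M \<PP> \<Longrightarrow> ennreal c * L1_norm Q X \<le> LPhi_norm \<PP> \<Phi> X"
    using Q by (auto simp: dual_probs_def dual_weights_def)
  have meas: "rep X \<in> borel_measurable Q" if "X \<in> L0 M \<PP>" for X
    using rep_measurable[OF that] measurable_cong_sets[OF sets refl] by blast
  have int: "integrable Q (rep X)" if X: "X \<in> LPhi M \<PP> \<Phi>" for X
  proof (rule integrableI_bounded)
    show "rep X \<in> borel_measurable Q" using X by (intro meas) (simp add: LPhi_def)
    have "ennreal c * L1_norm Q X < \<infinity>"
      using c(2)[of X] X by (auto simp: LPhi_def intro: le_less_trans)
    then show "(\<integral>\<^sup>+\<omega>. ennreal (norm (rep X \<omega>)) \<partial>Q) < \<infinity>"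
      using c(1) by (auto simp: L1_norm_def ennreal_mult_less_top)
  qed
  have cont: "\<bar>integral\<^sup>L Q (rep Y) - integral\<^sup>L Q (rep X)\<bar> < \<epsilon>"
    if X: "X \<in> LPhi M \<PP> \<Phi>" and Y: "Y \<in> LPhi M \<PP> \<Phi>"
      and less: "LPhi_norm \<PP> \<Phi> (qs_minus M \<PP> Y X) < ennreal (c * \<epsilon>)" for X Y \<epsilon>
  proof -
    have [measurable]: "rep X \<in> borel_measurable M" "rep Y \<in> borel_measurable M"
      using X Y by (auto simp: LPhi_def rep_measurable)
    have "qs_minus M \<PP> Y X \<in> L0 M \<PP>" unfolding qs_minus_def L0_iff by (rule bexI, rule refl) measurable
    \<comment> \<open>The representative of the difference class agrees with
      \<open>rep Y - rep X\<close> only quasi-surely; absolute continuity of \<open>Q\<close> allows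
      the replacement under the integral.\<close>
    from c(2)[OF this] less
    have "ennreal c * (\<integral>\<^sup>+\<omega>. ennreal \<bar>rep Y \<omega> - rep X \<omega>\<bar> \<partial>Q) < ennreal (c * \<epsilon>)"
      unfolding qs_minus_def by (subst (asm) L1_norm_qs_class) (use prob ac prob_measures in auto)
    also have "(\<integral>\<^sup>+\<omega>. ennreal \<bar>rep Y \<omega> - rep X \<omega>\<bar> \<partial>Q) = ennreal (\<integral>\<omega>. \<bar>rep Y \<omega> - rep X \<omega>\<bar> \<partial>Q)"
      using int[OF X] int[OF Y] by (intro nn_integral_eq_integral) auto
    finally have "c * (\<integral>\<omega>. \<bar>rep Y \<omega> - rep X \<omega>\<bar> \<partial>Q) < c * \<epsilon>"
      using c(1) by (simp add: ennreal_mult'[symmetric] ennreal_less_iff)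
    then have "(\<integral>\<omega>. \<bar>rep Y \<omega> - rep X \<omega>\<bar> \<partial>Q) < \<epsilon>" using c(1) by simp
    moreover have "\<bar>integral\<^sup>L Q (rep Y) - integral\<^sup>L Q (rep X)\<bar> \<le> (\<integral>\<omega>. \<bar>rep Y \<omega> - rep X \<omega>\<bar> \<partial>Q)"
      using integral_abs_bound[of Q "\<lambda>\<omega>. rep Y \<omega> - rep X \<omega>"] int[OF X] int[OF Y] by simp
    ultimately show ?thesis by linarith
  qed
  have "measure Q \<in> ca_LPhi M \<PP> \<Phi>"
    unfolding ca_LPhi_def mem_Collect_eq tv_measure_prob[OF prob]
  proof (intro conjI ballI allI impI)
    fix X and \<epsilon> :: real assume "X \<in> LPhi M \<PP> \<Phi>" "\<epsilon> > 0"
    then show "\<exists>\<delta>>0. \<forall>Y\<in>LPhi M \<PP> \<Phi>. LPhi_norm \<PP> \<Phi> (qs_minus M \<PP> Y X) < ennreal \<delta> \<longrightarrow>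
        \<bar>integral\<^sup>L Q (rep Y) - integral\<^sup>L Q (rep X)\<bar> < \<epsilon>"
      using cont c(1) by (intro exI[of _ "c * \<epsilon>"]) auto
  qed (use ac int in auto)
  then show "Q \<in> ca1_LPhi M \<PP> \<Phi>" using prob by (simp add: ca1_LPhi_def)
qed

text \<open>
  If \<open>u \<mapsto> Y \<omega> * u - B \<omega>\<close> minorizes \<open>\<Phi> P\<close> for every \<open>\<omega>\<close>, Young's inequality makes
  \<open>Y / (1 + E B)\<close> an element of the dual unit ball.
\<close>

lemma LPhi_norm_ge_weighted_L1:
  assumes P: "P \<in> \<PP>" and [measurable]: "Y \<in> borel_measurable P" "B \<in> borel_measurable P"
    and nonneg: "\<And>\<omega>. 0 \<le> Y \<omega>" "\<And>\<omega>. 0 \<le> B \<omega>"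
    and int: "integrable P B"
    and minor: "\<And>\<omega> u. 0 \<le> u \<Longrightarrow> ennreal (Y \<omega> * u - B \<omega>) \<le> \<Phi> P u"
    and X: "X \<in> L0 M \<PP>"
  shows "ennreal (1 / (1 + (\<integral>\<omega>. B \<omega> \<partial>P))) * (\<integral>\<^sup>+\<omega>. ennreal (Y \<omega> * \<bar>rep X \<omega>\<bar>) \<partial>P) \<le> LPhi_norm \<PP> \<Phi> X"
  unfolding LPhi_norm_def
proof (rule Inf_greatest, clarify)
  fix l :: real assume l: "0 < l"
    and le: "(SUP P\<in>\<PP>. \<integral>\<^sup>+\<omega>. \<Phi> P (inverse l * \<bar>rep X \<omega>\<bar>) \<partial>P) \<le> 1"
  define k where "k = 1 + (\<integral>\<omega>. B \<omega> \<partial>P)"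
  have k: "k > 0" using integral_nonneg_AE[of B P] nonneg by (auto simp: k_def add_pos_nonneg)
  have [measurable]: "rep X \<in> borel_measurable P" by (rule rep_measurable_PP[OF X P])
  have [measurable]: "(\<lambda>\<omega>. \<Phi> P (inverse l * \<bar>rep X \<omega>\<bar>)) \<in> borel_measurable P"
    using l by (intro borel_measurable_Orlicz Orlicz P) auto
  have "(\<integral>\<^sup>+\<omega>. ennreal (Y \<omega> * \<bar>rep X \<omega>\<bar>) \<partial>P) =
        (\<integral>\<^sup>+\<omega>. ennreal l * ennreal (Y \<omega> * (inverse l * \<bar>rep X \<omega>\<bar>)) \<partial>P)"
    using l nonneg by (intro nn_integral_cong) (simp add: ennreal_mult'[symmetric])
  also have "\<dots> = ennreal l * (\<integral>\<^sup>+\<omega>. ennreal (Y \<omega> * (inverse l * \<bar>rep X \<omega>\<bar>)) \<partial>P)"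
    by (rule nn_integral_cmult) measurable
  also have "(\<integral>\<^sup>+\<omega>. ennreal (Y \<omega> * (inverse l * \<bar>rep X \<omega>\<bar>)) \<partial>P) \<le>
      (\<integral>\<^sup>+\<omega>. \<Phi> P (inverse l * \<bar>rep X \<omega>\<bar>) + ennreal (B \<omega>) \<partial>P)"
  proof (rule nn_integral_mono)
    fix \<omega>
    let ?u = "inverse l * \<bar>rep X \<omega>\<bar>"
    \<comment> \<open>Only an inequality: \<open>ennreal\<close> truncates a negative difference to
      0, in which case \<open>Y \<omega> * ?u\<close> is below \<open>B \<omega>\<close>
      anyway.\<close>
    have "ennreal (Y \<omega> * ?u) \<le> ennreal (Y \<omega> * ?u - B \<omega>) + ennreal (B \<omega>)"
      by (smt (verit) ennreal_leI ennreal_neg ennreal_plus add_0 nonneg(2))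
    also have "\<dots> \<le> \<Phi> P ?u + ennreal (B \<omega>)"
      using l by (intro add_right_mono minor) auto
    finally show "ennreal (Y \<omega> * ?u) \<le> \<Phi> P ?u + ennreal (B \<omega>)" .
  qed
  also have "\<dots> = (\<integral>\<^sup>+\<omega>. \<Phi> P (inverse l * \<bar>rep X \<omega>\<bar>) \<partial>P) + (\<integral>\<^sup>+\<omega>. ennreal (B \<omega>) \<partial>P)"
    by (rule nn_integral_add) measurable
  also have "\<dots> \<le> 1 + ennreal (\<integral>\<omega>. B \<omega> \<partial>P)"
    using le P nonneg int by (intro add_mono) (auto simp: SUP_le_iff nn_integral_eq_integral)
  also have "\<dots> = ennreal k"
    using integral_nonneg_AE[of B P] nonneg by (simp add: k_def ennreal_plus flip: ennreal_1)
  finally have "(\<integral>\<^sup>+\<omega>. ennreal (Y \<omega> * \<bar>rep X \<omega>\<bar>) \<partial>P) \<le> ennreal l * ennreal k"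
    by (simp add: mult_left_mono)
  then have "ennreal (1 / k) * (\<integral>\<^sup>+\<omega>. ennreal (Y \<omega> * \<bar>rep X \<omega>\<bar>) \<partial>P) \<le>
      ennreal (1 / k) * (ennreal l * ennreal k)"
    by (rule mult_left_mono) simp
  also have "\<dots> = ennreal l" using k l by (simp add: ennreal_mult'[symmetric])
  finally show "ennreal (1 / (1 + (\<integral>\<omega>. B \<omega> \<partial>P))) * (\<integral>\<^sup>+\<omega>. ennreal (Y \<omega> * \<bar>rep X \<omega>\<bar>) \<partial>P) \<le> ennreal l"
    by (simp add: k_def)
qed

text \<open>Dividing \<open>Y\<close> by its mean \<open>m\<close> produces a probability density,
  and the factor \<open>m\<close> in the weight \<open>m / k\<close> undoes the division. The
  weighted \<open>L1\<close>-norm is therefore exactly the functional bounded by Young's inequality,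
  and null sets are inherited from \<open>P\<close>.\<close>

lemma dual_prob_of_density:
  assumes P: "P \<in> \<PP>" and [measurable]: "Y \<in> borel_measurable P" "B \<in> borel_measurable P"
    and nonneg: "\<And>\<omega>. 0 \<le> Y \<omega>" "\<And>\<omega>. 0 \<le> B \<omega>"
    and int: "integrable P Y" "integrable P B"
    and minor: "\<And>\<omega> u. 0 \<le> u \<Longrightarrow> ennreal (Y \<omega> * u - B \<omega>) \<le> \<Phi> P u"
    and pos: "0 < (\<integral>\<omega>. Y \<omega> \<partial>P)"
  defines "m \<equiv> (\<integral>\<omega>. Y \<omega> \<partial>P)" and "k \<equiv> 1 + (\<integral>\<omega>. B \<omega> \<partial>P)"
  defines "Q \<equiv> density P (\<lambda>\<omega>. ennreal (Y \<omega> / m))"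
  shows "Q \<in> dual_probs" and "m / k \<in> dual_weights Q"
    and "\<And>X. X \<in> L0 M \<PP> \<Longrightarrow>
      ennreal (m / k) * L1_norm Q X = ennreal (1 / k) * (\<integral>\<^sup>+\<omega>. ennreal (Y \<omega> * \<bar>rep X \<omega>\<bar>) \<partial>P)"
proof -
  have k: "k > 0" using integral_nonneg_AE[of B P] nonneg by (auto simp: k_def add_pos_nonneg)
  have m: "m > 0" using pos by (simp add: m_def)
  show L1: "ennreal (m / k) * L1_norm Q X = ennreal (1 / k) * (\<integral>\<^sup>+\<omega>. ennreal (Y \<omega> * \<bar>rep X \<omega>\<bar>) \<partial>P)"
    if X: "X \<in> L0 M \<PP>" for X
  proof -
    have [measurable]: "rep X \<in> borel_measurable P" by (rule rep_measurable_PP[OF X P])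
    have "L1_norm Q X = (\<integral>\<^sup>+\<omega>. ennreal (Y \<omega> / m) * ennreal \<bar>rep X \<omega>\<bar> \<partial>P)"
      unfolding L1_norm_def Q_def by (rule nn_integral_density) measurable
    also have "\<dots> = (\<integral>\<^sup>+\<omega>. ennreal (1 / m) * ennreal (Y \<omega> * \<bar>rep X \<omega>\<bar>) \<partial>P)"
      using m nonneg by (intro nn_integral_cong) (simp add: ennreal_mult'[symmetric])
    also have "\<dots> = ennreal (1 / m) * (\<integral>\<^sup>+\<omega>. ennreal (Y \<omega> * \<bar>rep X \<omega>\<bar>) \<partial>P)"
      by (rule nn_integral_cmult) measurable
    finally show ?thesis
      using m k by (simp add: mult.assoc[symmetric] ennreal_mult'[symmetric])
  qed
  show weight: "m / k \<in> dual_weights Q"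
    using LPhi_norm_ge_weighted_L1[OF P assms(2,3) nonneg int(2) minor, folded k_def] m k
    by (auto simp: dual_weights_def L1)
  have "emeasure Q (space Q) = (\<integral>\<^sup>+\<omega>. ennreal (Y \<omega> / m) \<partial>P)"
    unfolding Q_def by (simp add: emeasure_density cong: nn_integral_cong)
  also have "\<dots> = ennreal (\<integral>\<omega>. Y \<omega> / m \<partial>P)"
    using int nonneg m by (intro nn_integral_eq_integral) auto
  also have "\<dots> = 1" using m by (simp add: m_def)
  finally have "prob_space Q" by (rule prob_spaceI)
  then have prob: "Q \<in> prob_measures M" using sets_PP[OF P] by (simp add: prob_measures_def Q_def)
  have "measure Q \<in> ca_ac M \<PP>"
  proof (rule prob_in_ca_ac[OF prob])
    fix N assume "N \<in> sets M" "\<And>P. P \<in> \<PP> \<Longrightarrow> emeasure P N = 0"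
    then have "N \<in> null_sets P" using P sets_PP by auto
    then show "emeasure Q N = 0"
      unfolding Q_def using absolutely_continuousI_density[of "\<lambda>\<omega>. ennreal (Y \<omega> / m)" P]
      by (auto simp: absolutely_continuous_def)
  qed
  then show "Q \<in> dual_probs" using prob weight by (auto simp: dual_probs_def)
qed

text \<open>A constant slope \<open>a\<close> has normalized density 1, so the construction returns
  \<open>P\<close> itself, with weight \<open>a / (1 + b)\<close>.\<close>

lemma PP_subset_dual_probs: "\<PP> \<subseteq> dual_probs"
proof
  fix P assume P: "P \<in> \<PP>"
  interpret prob_space P using P by (rule prob_space_PP)
  obtain a b where ab: "0 < a" "0 \<le> b" "\<And>u. 0 \<le> u \<Longrightarrow> ennreal (a * u - b) \<le> \<Phi> P u"
    using Orlicz_affine_lower_bound[OF Orlicz[OF P]] by blast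
  have "density P (\<lambda>\<omega>. ennreal (a / (\<integral>\<omega>. a \<partial>P))) \<in> dual_probs"
    using P ab by (intro dual_prob_of_density(1)[where B = "\<lambda>_. b"]) (auto simp: prob_space)
  moreover have "density P (\<lambda>\<omega>. ennreal (a / (\<integral>\<omega>. a \<partial>P))) = P"
    using ab by (simp add: prob_space density_1)
  ultimately show "P \<in> dual_probs" by simp
qed

text \<open>A real level strictly below the norm is infeasible in the Luxemburg infimum, so a single
  \<open>P\<close> already has modular above 1. Working with levels also covers elements of infinite
  norm.\<close>

lemma ex_dual_prob_above:
  assumes X: "X \<in> L0 M \<PP>" and l: "0 < l" "ennreal l < LPhi_norm \<PP> \<Phi> X"
  obtains Q c where "Q \<in> dual_probs" "c \<in> dual_weights Q" "ennreal l \<le> ennreal c * L1_norm Q X"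
proof -
  define x where "x \<omega> = inverse l * \<bar>rep X \<omega>\<bar>" for \<omega>
  have x: "0 \<le> x \<omega>" for \<omega> using l by (simp add: x_def)
  have "\<not> (SUP P\<in>\<PP>. \<integral>\<^sup>+\<omega>. \<Phi> P (inverse l * \<bar>rep X \<omega>\<bar>) \<partial>P) \<le> 1"
  proof
    assume "(SUP P\<in>\<PP>. \<integral>\<^sup>+\<omega>. \<Phi> P (inverse l * \<bar>rep X \<omega>\<bar>) \<partial>P) \<le> 1"
    then have "LPhi_norm \<PP> \<Phi> X \<le> ennreal l"
      unfolding LPhi_norm_def using l(1) by (intro Inf_lower) auto
    then show False using l(2) by simp
  qed
  then obtain P where P: "P \<in> \<PP>" and gt: "1 < (\<integral>\<^sup>+\<omega>. \<Phi> P (x \<omega>) \<partial>P)"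
    by (auto simp: SUP_le_iff x_def not_le)
  interpret prob_space P using P by (rule prob_space_PP)
  have [measurable]: "rep X \<in> borel_measurable P" by (rule rep_measurable_PP[OF X P])
  have [measurable]: "x \<in> borel_measurable P" unfolding x_def by measurable
  show thesis
  proof (rule Orlicz_maximizing_lines[OF Orlicz[OF P]])
    fix Y B :: "nat \<Rightarrow> real \<Rightarrow> real"
    assume [measurable]: "\<And>n. Y n \<in> borel_measurable borel" "\<And>n. B n \<in> borel_measurable borel"
      and nonneg: "\<And>n x. 0 \<le> Y n x" "\<And>n x. 0 \<le> B n x"
      and bd: "\<And>n. \<exists>K. \<forall>x. Y n x \<le> K \<and> B n x \<le> K"
      and minor: "\<And>n x u. 0 \<le> u \<Longrightarrow> ennreal (Y n x * u - B n x) \<le> \<Phi> P u"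
      and inc: "\<And>x. incseq (\<lambda>n. Y n x * x - B n x)" and line: "\<And>n x. 0 \<le> Y n x * x - B n x"
      and eq: "\<And>x. 0 \<le> x \<Longrightarrow> (SUP n. ennreal (Y n x * x - B n x)) = \<Phi> P x"
    have "(\<integral>\<^sup>+\<omega>. \<Phi> P (x \<omega>) \<partial>P) = (\<integral>\<^sup>+\<omega>. (SUP n. ennreal (Y n (x \<omega>) * x \<omega> - B n (x \<omega>))) \<partial>P)"
      using eq x by simp
    also have "\<dots> = (SUP n. \<integral>\<^sup>+\<omega>. ennreal (Y n (x \<omega>) * x \<omega> - B n (x \<omega>)) \<partial>P)"
      using inc by (intro nn_integral_monotone_convergence_SUP)
        (auto simp: incseq_def le_fun_def intro!: ennreal_leI)
    finally obtain n where n: "1 < (\<integral>\<^sup>+\<omega>. ennreal (Y n (x \<omega>) * x \<omega> - B n (x \<omega>)) \<partial>P)"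
      using gt by (auto simp: less_SUP_iff)
    define y where "y \<omega> = Y n (x \<omega>)" for \<omega>
    define b where "b \<omega> = B n (x \<omega>)" for \<omega>
    have [measurable]: "y \<in> borel_measurable P" "b \<in> borel_measurable P"
      unfolding y_def b_def by measurable
    obtain K where "\<And>x. Y n x \<le> K" "\<And>x. B n x \<le> K" using bd by blast
    then have int: "integrable P y" "integrable P b"
      using nonneg by (auto intro!: integrable_const_bound[where B = K] simp: y_def b_def)
    define k where "k = 1 + (\<integral>\<omega>. b \<omega> \<partial>P)"
    have nn: "0 \<le> y \<omega>" "0 \<le> b \<omega>" for \<omega> using nonneg by (auto simp: y_def b_def)
    have k: "k > 0" using integral_nonneg_AE[of b P] nn by (auto simp: k_def add_pos_nonneg)
    \<comment> \<open>Adding \<open>E b\<close> on both sides of \<open>1 < E(y x - b)\<close> gives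
      \<open>k \<le> E(y x) = E(y |X|) / l\<close>; multiplying by \<open>l / k\<close> gives
      \<open>main\<close>.\<close>
    have "ennreal k = 1 + (\<integral>\<^sup>+\<omega>. ennreal (b \<omega>) \<partial>P)"
      using nn int integral_nonneg_AE[of b P]
      by (simp add: k_def nn_integral_eq_integral ennreal_plus flip: ennreal_1)
    also have "\<dots> \<le> (\<integral>\<^sup>+\<omega>. ennreal (y \<omega> * x \<omega> - b \<omega>) \<partial>P) + (\<integral>\<^sup>+\<omega>. ennreal (b \<omega>) \<partial>P)"
      using n by (intro add_right_mono) (simp add: y_def b_def)
    also have "\<dots> = (\<integral>\<^sup>+\<omega>. ennreal (y \<omega> * x \<omega> - b \<omega>) + ennreal (b \<omega>) \<partial>P)"
      by (rule nn_integral_add[symmetric]) measurable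
    also have "\<dots> = (\<integral>\<^sup>+\<omega>. ennreal (inverse l) * ennreal (y \<omega> * \<bar>rep X \<omega>\<bar>) \<partial>P)"
    proof (rule nn_integral_cong)
      fix \<omega>
      \<comment> \<open>An equality here, because the selected line is nonnegative at the point
        where it was selected and nothing is truncated.\<close>
      have "ennreal (y \<omega> * x \<omega> - b \<omega>) + ennreal (b \<omega>) = ennreal (y \<omega> * x \<omega>)"
        using line[of n "x \<omega>"] nn by (subst ennreal_plus[symmetric]) (auto simp: y_def b_def)
      also have "\<dots> = ennreal (inverse l * (y \<omega> * \<bar>rep X \<omega>\<bar>))"
        by (simp add: x_def mult.left_commute)
      also have "\<dots> = ennreal (inverse l) * ennreal (y \<omega> * \<bar>rep X \<omega>\<bar>)"
        using l nn by (intro ennreal_mult) auto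
      finally show "ennreal (y \<omega> * x \<omega> - b \<omega>) + ennreal (b \<omega>) =
        ennreal (inverse l) * ennreal (y \<omega> * \<bar>rep X \<omega>\<bar>)" .
    qed
    also have "\<dots> = ennreal (inverse l) * (\<integral>\<^sup>+\<omega>. ennreal (y \<omega> * \<bar>rep X \<omega>\<bar>) \<partial>P)"
      by (rule nn_integral_cmult) measurable
    finally have "ennreal (l / k) * ennreal k \<le>
        ennreal (l / k) * (ennreal (inverse l) * (\<integral>\<^sup>+\<omega>. ennreal (y \<omega> * \<bar>rep X \<omega>\<bar>) \<partial>P))"
      by (rule mult_left_mono) simp
    moreover have "ennreal (l / k) * ennreal k = ennreal l"
      using k l by (simp add: ennreal_mult'[symmetric])
    moreover have "ennreal (l / k) * ennreal (inverse l) = ennreal (1 / k)"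
      using k l by (simp add: ennreal_mult'[symmetric] field_simps)
    ultimately have main: "ennreal l \<le> ennreal (1 / k) * (\<integral>\<^sup>+\<omega>. ennreal (y \<omega> * \<bar>rep X \<omega>\<bar>) \<partial>P)"
      by (simp add: mult.assoc[symmetric])
    \<comment> \<open>Needed for normalizing \<open>y\<close>: a zero mean would make
      \<open>y\<close> vanish almost everywhere, and \<open>main\<close> would force
      \<open>l \<le> 0\<close>.\<close>
    have pos: "0 < (\<integral>\<omega>. y \<omega> \<partial>P)"
    proof (rule ccontr)
      assume "\<not> ?thesis"
      then have "(\<integral>\<omega>. y \<omega> \<partial>P) = 0" using integral_nonneg_AE[of y P] nn by (simp add: antisym)
      then have "AE \<omega> in P. y \<omega> = 0"
        using integral_nonneg_eq_0_iff_AE[of P y] int nn by simp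
      then have "(\<integral>\<^sup>+\<omega>. ennreal (y \<omega> * \<bar>rep X \<omega>\<bar>) \<partial>P) = (\<integral>\<^sup>+\<omega>. 0 \<partial>P)"
        by (intro nn_integral_cong_AE) (auto elim: eventually_mono)
      then show False using main l by simp
    qed
    have mn: "ennreal (y \<omega> * u - b \<omega>) \<le> \<Phi> P u" if "0 \<le> u" for \<omega> u
      unfolding y_def b_def using that by (rule minor)
    note dual = dual_prob_of_density[OF P _ _ nn int mn pos, folded k_def, simplified]
    show thesis
    proof (rule that[OF dual(1,2)])
      show "ennreal l \<le> ennreal ((\<integral>\<omega>. y \<omega> \<partial>P) / k) *
          L1_norm (density P (\<lambda>\<omega>. ennreal (y \<omega> / (\<integral>\<omega>. y \<omega> \<partial>P)))) X"
        using main dual(3)[OF X] by simp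
    qed
  qed
qed

section \<open>Bounded random variables and the norm of the constant 1\<close>

lemma const_in_Linf: "qs_class M \<PP> (\<lambda>_. c) \<in> Linf M \<PP>"
  unfolding Linf_def L0_iff
  by (auto intro!: bexI[of _ "\<lambda>_. c"] self_in_qs_class simp: bounded_def image_constant_conv)

lemma Linf_bounded:
  assumes "X \<in> Linf M \<PP>"
  obtains f m where "f \<in> borel_measurable M" "X = qs_class M \<PP> f" "0 < m"
    "\<And>\<omega>. \<omega> \<in> space M \<Longrightarrow> \<bar>f \<omega>\<bar> \<le> m"
proof -
  obtain f where f: "f \<in> X" "bounded (f ` space M)" and X: "X \<in> L0 M \<PP>"
    using assms by (auto simp: Linf_def)
  obtain g where g: "g \<in> borel_measurable M" "X = qs_class M \<PP> g" using X by (auto simp: L0_iff)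
  then have gf: "(g, f) \<in> qs_rel M \<PP>" using f by (simp add: qs_class_def)
  then have "X = qs_class M \<PP> f"
    unfolding g(2) qs_class_def by (rule equiv_class_eq[OF equiv_qs_rel])
  moreover have "f \<in> borel_measurable M" using gf by (simp add: qs_rel_def)
  moreover obtain m where "0 < m" "\<forall>z\<in>f ` space M. norm z \<le> m"
    using f(2) by (auto simp: bounded_pos)
  ultimately show thesis using that by auto
qed

lemma Linf_norm_finite:
  assumes "X \<in> Linf M \<PP>"
  shows "Linf_norm M \<PP> X < \<infinity>"
proof -
  obtain f m where f: "f \<in> borel_measurable M" "X = qs_class M \<PP> f" "0 < m"
      "\<And>\<omega>. \<omega> \<in> space M \<Longrightarrow> \<bar>f \<omega>\<bar> \<le> m"
    using Linf_bounded[OF assms] by blast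
  have "AE \<omega> in P. \<bar>f \<omega>\<bar> \<le> m" if "P \<in> \<PP>" for P
    using f(4) sets_eq_imp_space_eq[OF sets_PP[OF that]] by (intro AE_I2) simp
  then have "Linf_norm M \<PP> X \<le> ennreal m"
    unfolding f(2) Linf_norm_qs_class[OF f(1)] using f(3) by (intro Inf_lower) auto
  then show ?thesis by (rule le_less_trans) simp
qed

text \<open>At the constant 1, each \<open>P\<close> being a probability measure, the robust modular
  at level \<open>l\<close> is \<open>phi_Max\<close> at \<open>1 / l\<close>; any feasible
  \<open>l\<close> thus provides \<open>x0\<close>.\<close>

lemma phi_Max_finite_if_LPhi_norm_const:
  assumes "LPhi_norm \<PP> \<Phi> (qs_class M \<PP> (\<lambda>_. 1)) < \<infinity>"
  shows "\<exists>x0>0. phi_Max \<PP> \<Phi> x0 < \<infinity>"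
proof -
  obtain l :: real where l: "0 < l" "(SUP P\<in>\<PP>. \<integral>\<^sup>+\<omega>. \<Phi> P (inverse l * \<bar>1\<bar>) \<partial>P) \<le> 1"
    using assms by (subst (asm) LPhi_norm_qs_class) (auto simp: Inf_less_iff)
  have "phi_Max \<PP> \<Phi> (inverse l) = (SUP P\<in>\<PP>. \<integral>\<^sup>+\<omega>. \<Phi> P (inverse l * \<bar>1\<bar>) \<partial>P)"
    unfolding phi_Max_def
    by (intro SUP_cong refl) (simp add: prob_space.emeasure_space_1[OF prob_space_PP])
  then have "phi_Max \<PP> \<Phi> (inverse l) < \<infinity>"
    using l(2) by (metis ennreal_one_less_top infinity_ennreal_def order.strict_trans1)
  then show ?thesis using l(1) by (intro exI[of _ "inverse l"]) simp
qed

text \<open>Convexity and the value 0 at 0 allow shrinking \<open>x0\<close> to a point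
  \<open>y\<close> where all \<open>\<Phi> P\<close> are at most 1. Then \<open>|X| \<le> m\<close>
  makes \<open>m / y\<close> feasible, so \<open>\<kappa> = 1 / y\<close>.\<close>

lemma LPhi_norm_le_Linf_norm:
  assumes "0 < x0" "phi_Max \<PP> \<Phi> x0 < \<infinity>"
  shows "\<exists>\<kappa>>0. \<forall>X\<in>Linf M \<PP>. LPhi_norm \<PP> \<Phi> X \<le> ennreal \<kappa> * Linf_norm M \<PP> X"
proof -
  obtain p where p: "0 \<le> p" "phi_Max \<PP> \<Phi> x0 = ennreal p"
    using assms by (cases "phi_Max \<PP> \<Phi> x0") auto
  \<comment> \<open>The summand 1 keeps \<open>t\<close> well defined for \<open>p = 0\<close> and
    at most 1, as convexity requires, while still \<open>t * p \<le> 1\<close>.\<close>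
  define t where "t = 1 / (1 + p)"
  have t: "0 < t" "t \<le> 1" "t * p \<le> 1" using p by (auto simp: t_def field_simps)
  define y where "y = t * x0"
  have y: "0 < y" using t assms by (simp add: y_def)
  have le1: "\<Phi> P y \<le> 1" if P: "P \<in> \<PP>" for P
  proof -
    have "\<Phi> P ((1 - t) * 0 + t * x0) \<le> ennreal (1 - t) * \<Phi> P 0 + ennreal t * \<Phi> P x0"
      using Orlicz[OF P] t assms(1) unfolding Orlicz_function_def convex_nonneg_def by auto
    also have "\<dots> = ennreal t * \<Phi> P x0" using Orlicz[OF P] by (simp add: Orlicz_function_def)
    also have "\<dots> \<le> ennreal t * phi_Max \<PP> \<Phi> x0"
      unfolding phi_Max_def by (intro mult_left_mono SUP_upper P) simp
    also have "\<dots> \<le> 1" using t p by (simp add: ennreal_mult[symmetric])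
    finally show ?thesis by (simp add: y_def)
  qed
  have "LPhi_norm \<PP> \<Phi> X \<le> ennreal (1 / y) * Linf_norm M \<PP> X" if X: "X \<in> Linf M \<PP>" for X
  proof -
    obtain f where f: "f \<in> borel_measurable M" "X = qs_class M \<PP> f"
      using Linf_bounded[OF X] by metis
    \<comment> \<open>The constant is moved to the left so that the right side is a bare infimum and
      each admissible bound \<open>m\<close> can be treated separately.\<close>
    have "ennreal y * LPhi_norm \<PP> \<Phi> X \<le> Linf_norm M \<PP> X"
      unfolding f(2) Linf_norm_qs_class[OF f(1)]
    proof (rule Inf_greatest, clarify)
      fix m :: real assume m: "0 < m" "\<forall>P\<in>\<PP>. AE \<omega> in P. \<bar>f \<omega>\<bar> \<le> m"
      have "(\<integral>\<^sup>+\<omega>. \<Phi> P (inverse (m / y) * \<bar>f \<omega>\<bar>) \<partial>P) \<le> 1" if P: "P \<in> \<PP>" for P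
      proof -
        have mono: "mono_on {0..} (\<Phi> P)" using Orlicz[OF P] by (simp add: Orlicz_function_def)
        have "AE \<omega> in P. \<Phi> P (inverse (m / y) * \<bar>f \<omega>\<bar>) \<le> 1"
          using m(2)[rule_format, OF P]
        proof eventually_elim
          fix \<omega> assume "\<bar>f \<omega>\<bar> \<le> m"
          then have "\<Phi> P (inverse (m / y) * \<bar>f \<omega>\<bar>) \<le> \<Phi> P y"
            using m y by (intro mono_onD[OF mono]) (auto simp: field_simps)
          then show "\<Phi> P (inverse (m / y) * \<bar>f \<omega>\<bar>) \<le> 1" using le1[OF P] by (rule order_trans)
        qed
        then have "(\<integral>\<^sup>+\<omega>. \<Phi> P (inverse (m / y) * \<bar>f \<omega>\<bar>) \<partial>P) \<le> (\<integral>\<^sup>+\<omega>. 1 \<partial>P)"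
          by (rule nn_integral_mono_AE)
        then show ?thesis by (simp add: prob_space.emeasure_space_1[OF prob_space_PP[OF P]])
      qed
      then have "LPhi_norm \<PP> \<Phi> (qs_class M \<PP> f) \<le> ennreal (m / y)"
        unfolding LPhi_norm_qs_class[OF f(1)] using m y
        by (intro Inf_lower) (auto intro!: SUP_least)
      then have "ennreal y * LPhi_norm \<PP> \<Phi> (qs_class M \<PP> f) \<le> ennreal y * ennreal (m / y)"
        by (rule mult_left_mono) simp
      then show "ennreal y * LPhi_norm \<PP> \<Phi> (qs_class M \<PP> f) \<le> ennreal m"
        using m y by (simp add: ennreal_mult'[symmetric])
    qed
    then have "ennreal (1 / y) * (ennreal y * LPhi_norm \<PP> \<Phi> X) \<le> ennreal (1 / y) * Linf_norm M \<PP> X"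
      by (rule mult_left_mono) simp
    then show ?thesis using y by (simp add: mult.assoc[symmetric] ennreal_mult'[symmetric])
  qed
  then show ?thesis using y by (intro exI[of _ "1 / y"]) auto
qed

lemma Linf_subset_LPhi_if_norm_le:
  assumes "\<forall>X\<in>Linf M \<PP>. LPhi_norm \<PP> \<Phi> X \<le> ennreal \<kappa> * Linf_norm M \<PP> X"
  shows "Linf M \<PP> \<subseteq> LPhi M \<PP> \<Phi>"
proof
  fix X assume X: "X \<in> Linf M \<PP>"
  have "LPhi_norm \<PP> \<Phi> X \<le> ennreal \<kappa> * Linf_norm M \<PP> X" using assms X by blast
  also have "\<dots> < \<infinity>" using Linf_norm_finite[OF X] by (simp add: ennreal_mult_less_top)
  finally show "X \<in> LPhi M \<PP> \<Phi>" using X by (simp add: LPhi_def Linf_def)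
qed

section \<open>The weighted \<open>L1\<close> representation\<close>

definition is_weighted_L1 :: "'a measure set \<Rightarrow> ('a measure \<Rightarrow> real) \<Rightarrow> bool" where
  "is_weighted_L1 \<QQ> \<theta> \<longleftrightarrow> \<QQ> \<noteq> {} \<and> \<QQ> \<subseteq> ca1_LPhi M \<PP> \<Phi> \<and> \<PP> \<subseteq> \<QQ> \<and>
     (\<forall>Q\<in>\<QQ>. \<theta> Q > 0) \<and> bounded (\<theta> ` \<QQ>) \<and>
     (\<forall>X\<in>L0 M \<PP>. LPhi_norm \<PP> \<Phi> X = (SUP Q\<in>\<QQ>. ennreal (\<theta> Q) * L1_norm Q X))"

text \<open>At the constant 1 a weighted \<open>L1\<close>-norm reduces to its weight, which ties
  boundedness of the weights to finiteness of the norm of 1.\<close>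

lemma L1_norm_const:
  assumes "Q \<in> prob_measures M" "measure Q \<in> ca_ac M \<PP>"
  shows "L1_norm Q (qs_class M \<PP> (\<lambda>_. 1)) = 1"
  using assms prob_measures
  by (subst L1_norm_qs_class) (auto simp: prob_measures_def prob_space.emeasure_space_1)

lemma LPhi_norm_const_if_weighted_L1:
  assumes "is_weighted_L1 \<QQ> \<theta>"
  shows "LPhi_norm \<PP> \<Phi> (qs_class M \<PP> (\<lambda>_. 1)) < \<infinity>"
proof -
  have "bounded (\<theta> ` \<QQ>)" using assms by (simp add: is_weighted_L1_def)
  then obtain K where "\<forall>z\<in>\<theta> ` \<QQ>. norm z \<le> K" by (auto simp: bounded_iff)
  then have K: "\<theta> Q \<le> K" if "Q \<in> \<QQ>" for Q using that by (auto intro: abs_le_D1)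
  have one: "qs_class M \<PP> (\<lambda>_. 1) \<in> L0 M \<PP>" by (auto simp: L0_iff)
  have "L1_norm Q (qs_class M \<PP> (\<lambda>_. 1)) = 1" if "Q \<in> \<QQ>" for Q
    using assms that by (intro L1_norm_const) (auto simp: is_weighted_L1_def ca1_LPhi_def ca_LPhi_def)
  then have "LPhi_norm \<PP> \<Phi> (qs_class M \<PP> (\<lambda>_. 1)) = (SUP Q\<in>\<QQ>. ennreal (\<theta> Q))"
    using assms one by (simp add: is_weighted_L1_def)
  also have "\<dots> \<le> ennreal K" by (intro SUP_least ennreal_leI K)
  finally show ?thesis by (rule le_less_trans) simp
qed

lemma weighted_L1_if_LPhi_norm_const:
  assumes fin: "LPhi_norm \<PP> \<Phi> (qs_class M \<PP> (\<lambda>_. 1)) < \<infinity>"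
  shows "is_weighted_L1 dual_probs (\<lambda>Q. enn2real (SUP c\<in>dual_weights Q. ennreal c))"
proof -
  let ?I = "qs_class M \<PP> (\<lambda>_. 1)"
  let ?\<theta> = "\<lambda>Q. SUP c\<in>dual_weights Q. ennreal c"
  have one: "?I \<in> L0 M \<PP>" by (auto simp: L0_iff)
  have le: "?\<theta> Q \<le> LPhi_norm \<PP> \<Phi> ?I" if "Q \<in> dual_probs" for Q
  proof (rule SUP_least)
    fix c assume "c \<in> dual_weights Q"
    then have "ennreal c * L1_norm Q ?I \<le> LPhi_norm \<PP> \<Phi> ?I" using one by (simp add: dual_weights_def)
    then show "ennreal c \<le> LPhi_norm \<PP> \<Phi> ?I"
      using that L1_norm_const by (simp add: dual_probs_def)
  qed
  \<comment> \<open>Finiteness matters: \<open>enn2real\<close> would send an infinite supremum to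
    0. Testing at the constant 1 has bounded every admissible weight by its norm.\<close>
  have eq: "ennreal (enn2real (?\<theta> Q)) = ?\<theta> Q" if "Q \<in> dual_probs" for Q
    using le[OF that] fin by (intro ennreal_enn2real) (auto intro: le_less_trans)
  have pos: "0 < enn2real (?\<theta> Q)" if Q: "Q \<in> dual_probs" for Q
  proof -
    obtain c where c: "c \<in> dual_weights Q" using Q by (auto simp: dual_probs_def)
    then have "0 < ennreal c" by (simp add: dual_weights_def)
    also have "ennreal c \<le> ?\<theta> Q" using c by (rule SUP_upper)
    finally have "ennreal 0 < ennreal (enn2real (?\<theta> Q))" unfolding eq[OF Q] by simp
    then show ?thesis using enn2real_nonneg ennreal_less_iff by blast
  qed
  have bdd: "bounded ((\<lambda>Q. enn2real (?\<theta> Q)) ` dual_probs)"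
    unfolding bounded_iff using le fin
    by (intro exI[of _ "enn2real (LPhi_norm \<PP> \<Phi> ?I)"]) (auto intro!: enn2real_mono)
  have norm: "LPhi_norm \<PP> \<Phi> X = (SUP Q\<in>dual_probs. ennreal (enn2real (?\<theta> Q)) * L1_norm Q X)"
    (is "_ = ?S") if X: "X \<in> L0 M \<PP>" for X
  proof (rule antisym)
    show "?S \<le> LPhi_norm \<PP> \<Phi> X"
    proof (rule SUP_least)
      fix Q assume Q: "Q \<in> dual_probs"
      have "ennreal (enn2real (?\<theta> Q)) * L1_norm Q X = (SUP c\<in>dual_weights Q. ennreal c * L1_norm Q X)"
        unfolding eq[OF Q] by (rule SUP_mult_right_ennreal)
      also have "\<dots> \<le> LPhi_norm \<PP> \<Phi> X"
        using X by (intro SUP_least) (simp add: dual_weights_def)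
      finally show "ennreal (enn2real (?\<theta> Q)) * L1_norm Q X \<le> LPhi_norm \<PP> \<Phi> X" .
    qed
    show "LPhi_norm \<PP> \<Phi> X \<le> ?S"
    proof (rule ccontr)
      assume "\<not> ?thesis"
      then have "?S < LPhi_norm \<PP> \<Phi> X" by simp
      \<comment> \<open>A level strictly between the two sides is finite and positive, so some dual
        measure reaches it, contradicting that it lies above \<open>?S\<close>.\<close>
      then obtain z where z: "?S < z" "z < LPhi_norm \<PP> \<Phi> X" using dense by blast
      then obtain l where l: "z = ennreal l" "0 \<le> l" by (cases z) auto
      have "0 < l" using l z by (cases "l = 0") auto
      obtain Q c where Q: "Q \<in> dual_probs" "c \<in> dual_weights Q" "ennreal l \<le> ennreal c * L1_norm Q X"
        using ex_dual_prob_above[OF X \<open>0 < l\<close>] z l by metis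
      note Q(3)
      also have "ennreal c * L1_norm Q X \<le> ?\<theta> Q * L1_norm Q X"
        using Q(2) by (intro mult_right_mono SUP_upper) auto
      also have "\<dots> = ennreal (enn2real (?\<theta> Q)) * L1_norm Q X" using eq[OF Q(1)] by simp
      also have "\<dots> \<le> ?S" by (rule SUP_upper[OF Q(1)])
      finally show False using z l by simp
    qed
  qed
  show ?thesis
    unfolding is_weighted_L1_def
    using nonempty PP_subset_dual_probs dual_probs_subset_ca1 pos bdd norm by blast
qed

end

section \<open>The equivalences\<close>

theorem theorem3p6:
  fixes M :: "'a measure"
    and \<PP> :: "'a measure set"
    and \<Phi> :: "'a measure \<Rightarrow> real \<Rightarrow> ennreal"
  assumes "\<PP> \<noteq> {}"
    and "\<PP> \<subseteq> prob_measures M"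
    and "\<And>P. P \<in> \<PP> \<Longrightarrow> Orlicz_function (\<Phi> P)"
  shows
    "(Linf M \<PP> \<subseteq> LPhi M \<PP> \<Phi> \<longleftrightarrow> Orlicz_function (phi_Max \<PP> \<Phi>)) \<and>
     (Orlicz_function (phi_Max \<PP> \<Phi>) \<longleftrightarrow> (\<exists>x0>0. phi_Max \<PP> \<Phi> x0 < \<infinity>)) \<and>
     (Orlicz_function (phi_Max \<PP> \<Phi>) \<longleftrightarrow>
        (\<exists>\<QQ> (\<theta> :: 'a measure \<Rightarrow> real).
           \<QQ> \<noteq> {} \<and> \<QQ> \<subseteq> ca1_LPhi M \<PP> \<Phi> \<and> \<PP> \<subseteq> \<QQ> \<and>
           (\<forall>Q\<in>\<QQ>. \<theta> Q > 0) \<and> bounded (\<theta> ` \<QQ>) \<and>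
           (\<forall>X\<in>L0 M \<PP>. LPhi_norm \<PP> \<Phi> X = (SUP Q\<in>\<QQ>. ennreal (\<theta> Q) * L1_norm Q X)))) \<and>
     (Orlicz_function (phi_Max \<PP> \<Phi>) \<longleftrightarrow>
        (\<exists>\<kappa>>0. \<forall>X\<in>Linf M \<PP>. LPhi_norm \<PP> \<Phi> X \<le> ennreal \<kappa> * Linf_norm M \<PP> X))"
proof -
  interpret robust_Orlicz M \<PP> \<Phi> using assms by unfold_locales
  \<comment> \<open>Finiteness of the norm of the constant 1 is the hub. The Orlicz property gives
    the norm estimate, that gives the inclusion, the inclusion gives finiteness at 1, and this
    returns the Orlicz property; the weighted representation is equivalent to finiteness at 1
    directly.\<close>
  let ?one = "qs_class M \<PP> (\<lambda>_. 1)"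
  have iff: "Orlicz_function (phi_Max \<PP> \<Phi>) \<longleftrightarrow> (\<exists>x0>0. phi_Max \<PP> \<Phi> x0 < \<infinity>)"
    using Orlicz_phi_Max_iff assms(1,3) by blast
  have norm_le: "Orlicz_function (phi_Max \<PP> \<Phi>) \<Longrightarrow>
      \<exists>\<kappa>>0. \<forall>X\<in>Linf M \<PP>. LPhi_norm \<PP> \<Phi> X \<le> ennreal \<kappa> * Linf_norm M \<PP> X"
    using iff LPhi_norm_le_Linf_norm by blast
  have Linf: "Linf M \<PP> \<subseteq> LPhi M \<PP> \<Phi> \<Longrightarrow> LPhi_norm \<PP> \<Phi> ?one < \<infinity>"
    using const_in_Linf[of 1] by (auto simp: LPhi_def)
  have Orl: "LPhi_norm \<PP> \<Phi> ?one < \<infinity> \<Longrightarrow> Orlicz_function (phi_Max \<PP> \<Phi>)"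
    using iff phi_Max_finite_if_LPhi_norm_const by blast
  have "(\<exists>\<QQ> \<theta>. is_weighted_L1 \<QQ> \<theta>) \<longleftrightarrow> LPhi_norm \<PP> \<Phi> ?one < \<infinity>"
    using LPhi_norm_const_if_weighted_L1 weighted_L1_if_LPhi_norm_const by blast
  then have L1: "(\<exists>\<QQ> \<theta>. is_weighted_L1 \<QQ> \<theta>) \<longleftrightarrow> Orlicz_function (phi_Max \<PP> \<Phi>)"
    using norm_le Linf_subset_LPhi_if_norm_le Linf Orl by blast
  have 1: "Linf M \<PP> \<subseteq> LPhi M \<PP> \<Phi> \<longleftrightarrow> Orlicz_function (phi_Max \<PP> \<Phi>)"
    and 4: "Orlicz_function (phi_Max \<PP> \<Phi>) \<longleftrightarrow>
      (\<exists>\<kappa>>0. \<forall>X\<in>Linf M \<PP>. LPhi_norm \<PP> \<Phi> X \<le> ennreal \<kappa> * Linf_norm M \<PP> X)"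
    using norm_le Linf_subset_LPhi_if_norm_le Linf Orl by blast+
  from 1 iff L1[symmetric] 4 show ?thesis unfolding is_weighted_L1_def by (intro conjI)
qed

end
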